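(* Let $G\subset\mathbb{Z}\times\mathbb{Z}^n$ be a graded semigroup of complete rank and with finite sections. If $G$ has limited growth, then there is a semigroup $M$ of some type $(C,T,A)$ which approximates the semigroup $G$. Such a semigroup $M$ is unique.
   Context: Write points of $\mathbb{R}\times\mathbb{R}^n$ as $(h,\mathbf{x})$. A graded semigroup is a semigroup $G\subset\mathbb{Z}\times\mathbb{Z}^n$ contained in the half-space $h\ge0$ such that for each $d\in\mathbb{N}$ (positive integers) the set $G(d)$ of elements of $G$ with first coordinate $d$ ("of degree $d$") is non-empty. $G$ has finite sections if $G(d)$ is finite for every $d>0$; then $H_G(d)=\#G(d)$. $G$ has limited growth if it has finite sections and there is a constant $q$ with $H_G(d)<q\,d^n$ for all $d>0$. $G$ has complete rank if the subgroup of $\mathbb{Z}\times\mathbb{Z}^n$ generated by $G$ has finite index. A positive cone is a closed convex $(n+1)$-dimensional cone $C$ (with apex at the origin) in the half-space $h\ge0$ with $C\cap\{h=0\}=\{0\}$. Let $C$ be a positive cone, $T\subset\mathbb{Z}^n=\{0\}\times\mathbb{Z}^n$ a subgroup of finite index, and $A\in\{1\}\times\mathbb{Z}^n$. The semigroup of type $(C,T,A)$ is $C\cap\{lA+t: l\in\mathbb{Z},\,t\in T\}$. A semigroup $M$ of type $(C,T,A)$ approximates $G$ if $G\subseteq M$ and $\lim_{d\to\infty} r_{G,M}(d)/d=0$, where, with $M(d),G(d),C(d)$ the sections by the hyperplane $h=d$, $r_{G,M}(d)$ is the maximum distance from a point of $M(d)\setminus G(d)$ to the boundary of $C(d)$ (boundary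 taken in the hyperplane $h=d$; $r_{G,M}(d)=0$ if $M(d)\setminus G(d)$ is empty). *)

theory Defs
  imports "HOL-Analysis.Analysis" "HOL-Computational_Algebra.Group_Closure"
begin

text \<open>The lattice \<open>\<int> \<times> \<int>\<^sup>n\<close> is the type \<open>int \<times> (int ^ 'n)\<close> with \<open>n = CARD('n)\<close>; it is viewed inside
  \<open>\<real> \<times> \<real>\<^sup>n\<close> through \<open>real_point\<close>.\<close>

definition real_vec :: "int ^ 'n \<Rightarrow> real ^ 'n" where
  "real_vec x = (\<chi> i. real_of_int (x $ i))"

definition real_point :: "int \<times> (int ^ 'n) \<Rightarrow> real \<times> (real ^ 'n)" where
  "real_point p = (real_of_int (fst p), real_vec (snd p))"

text \<open>The section \<open>S(d)\<close> by the hyperplane \<open>h = d\<close>. The hyperplane is identified (isometrically) with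
  \<open>\<real>\<^sup>n\<close> by dropping the coordinate \<open>h\<close>, so the frontier of a section is its boundary relative to
  the hyperplane.\<close>

definition slice :: "'a \<Rightarrow> ('a \<times> 'b) set \<Rightarrow> 'b set" where
  "slice d S = {x. (d, x) \<in> S}"

definition graded_semigroup :: "(int \<times> (int ^ 'n)) set \<Rightarrow> bool" where
  "graded_semigroup G \<longleftrightarrow>
     (\<forall>p\<in>G. \<forall>q\<in>G. p + q \<in> G) \<and> (\<forall>p\<in>G. fst p \<ge> 0) \<and> (\<forall>d>0. slice d G \<noteq> {})"

definition finite_sections :: "(int \<times> (int ^ 'n)) set \<Rightarrow> bool" where
  "finite_sections G \<longleftrightarrow> (\<forall>d>0. finite (slice d G))"

definition limited_growth :: "(int \<times> (int ^ 'n)) set \<Rightarrow> bool" where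
  "limited_growth G \<longleftrightarrow> finite_sections G \<and>
     (\<exists>q::real. \<forall>d>0. real (card (slice d G)) < q * real_of_int d ^ CARD('n))"

definition add_subgroup :: "'a::ab_group_add set \<Rightarrow> bool" where
  "add_subgroup H \<longleftrightarrow> 0 \<in> H \<and> (\<forall>x\<in>H. \<forall>y\<in>H. x + y \<in> H) \<and> (\<forall>x\<in>H. - x \<in> H)"

text \<open>The set of cosets of \<open>H\<close> is finite (used for subgroups only).\<close>

definition finite_index :: "'a::ab_group_add set \<Rightarrow> bool" where
  "finite_index H \<longleftrightarrow> finite (range (\<lambda>x. (+) x ` H))"

definition complete_rank :: "(int \<times> (int ^ 'n)) set \<Rightarrow> bool" where
  "complete_rank G \<longleftrightarrow> finite_index (group_closure G)"

definition positive_cone :: "(real \<times> (real ^ 'n)) set \<Rightarrow> bool" where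
  "positive_cone C \<longleftrightarrow>
     closed C \<and> convex C \<and> cone C \<and> aff_dim C = int (CARD('n) + 1) \<and>
     (\<forall>p\<in>C. fst p \<ge> 0) \<and> C \<inter> {p. fst p = 0} = {0}"

text \<open>\<open>semigroup_of_type C T A M\<close>: \<open>M\<close> is the semigroup of type \<open>(C, T, A)\<close>. The subgroup \<open>T\<close> of
  \<open>{0} \<times> \<int>\<^sup>n\<close> is given as a subset of \<open>\<int>\<^sup>n\<close>, and the pair \<open>(l * fst A, l *s snd A + t)\<close> is \<open>lA + t\<close>.\<close>

definition semigroup_of_type ::
  "(real \<times> (real ^ 'n)) set \<Rightarrow> (int ^ 'n) set \<Rightarrow> int \<times> (int ^ 'n) \<Rightarrow> (int \<times> (int ^ 'n)) set \<Rightarrow> bool" where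
  "semigroup_of_type C T A M \<longleftrightarrow>
     positive_cone C \<and> add_subgroup T \<and> finite_index T \<and> fst A = 1 \<and>
     M = {p. real_point p \<in> C \<and> (\<exists>l. \<exists>t\<in>T. p = (l * fst A, l *s snd A + t))}"

text \<open>\<open>defect C M G d\<close> is \<open>r\<^bsub>G,M\<^esub>(d)\<close>; the cone \<open>C\<close> is an explicit argument because the distances are to
  the boundary of \<open>C(d)\<close>. For \<open>M\<close> of type \<open>(C, T, A)\<close> and \<open>d > 0\<close> the set \<open>M(d)\<close> is finite, since \<open>C(d)\<close>
  is compact, so the maximum exists.\<close>

definition defect ::
  "(real \<times> (real ^ 'n)) set \<Rightarrow> (int \<times> (int ^ 'n)) set \<Rightarrow> (int \<times> (int ^ 'n)) set \<Rightarrow> nat \<Rightarrow> real" where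
  "defect C M G d =
     (let D = slice (int d) M - slice (int d) G in
      if D = {} then 0
      else Max ((\<lambda>x. infdist (real_vec x) (frontier (slice (real d) C))) ` D))"

definition approximates ::
  "(real \<times> (real ^ 'n)) set \<Rightarrow> (int \<times> (int ^ 'n)) set \<Rightarrow> (int \<times> (int ^ 'n)) set \<Rightarrow> bool" where
  "approximates C M G \<longleftrightarrow> G \<subseteq> M \<and> (\<lambda>d. defect C M G d / real d) \<longlonglongrightarrow> 0"

end

theory Submission
  imports Defs
begin

text \<open>Let \<open>L\<close> be the group generated by \<open>G\<close> and \<open>C\<close> the closure of the convex cone over \<open>G\<close>; the approximating
  semigroup is \<open>C \<inter> L\<close>. If \<open>G\<close> were not contained in a set \<open>\<bar>x\<bar> \<le> R h\<close>, then adjoining one far away element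
  to a semigroup spanned by a basis would produce more than \<open>q d\<^sup>n\<close> elements in some degree \<open>d\<close>; hence
  \<open>C\<close> is a positive cone. Inside a cone spanned by finitely many elements of \<open>G\<close>, every point of \<open>L\<close> lying in a
  suitable translate of the cone belongs to \<open>G\<close> (Khovanskii); by compactness of \<open>C(1)\<close> the points of
  \<open>C \<inter> L\<close> missing from \<open>G\<close> are close to the boundary. Conversely, an approximating semigroup agrees
  with \<open>G\<close> near rays through interior points of its cone in high degrees, which determines both its
  lattice and its cone.\<close>

section \<open>The lattice and its embedding into real space\<close>

text \<open>The integer scalar action on the lattice; it lets the elements \<open>lA + t\<close> of
  a type be written \<open>zscale l A + (0, t)\<close>.\<close>

definition zscale :: "int \<Rightarrow> int \<times> (int ^ 'n) \<Rightarrow> int \<times> (int ^ 'n)" where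
  "zscale l p = (l * fst p, l *s snd p)"

lemma zscale_add_left: "zscale (k + l) p = zscale k p + zscale l p"
  by (simp add: zscale_def prod_eq_iff vec_eq_iff distrib_right)

lemma zscale_minus_left: "zscale (- k) p = - zscale k p"
  by (simp add: zscale_def prod_eq_iff vec_eq_iff)

lemma zscale_0 [simp]: "zscale 0 p = 0"
  by (simp add: zscale_def prod_eq_iff vec_eq_iff)

lemma zscale_1 [simp]: "zscale 1 p = p"
  by (simp add: zscale_def prod_eq_iff vec_eq_iff)

lemma fst_zscale [simp]: "fst (zscale l p) = l * fst p"
  by (simp add: zscale_def)

lemma real_point_0 [simp]: "real_point 0 = 0"
  by (simp add: real_point_def real_vec_def prod_eq_iff vec_eq_iff)

lemma real_point_add: "real_point (p + q) = real_point p + real_point q"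
  by (simp add: real_point_def real_vec_def prod_eq_iff vec_eq_iff)

lemma real_point_diff: "real_point (p - q) = real_point p - real_point q"
  by (simp add: real_point_def real_vec_def prod_eq_iff vec_eq_iff)

lemma real_point_zscale: "real_point (zscale l p) = of_int l *\<^sub>R real_point p"
  by (simp add: real_point_def real_vec_def zscale_def prod_eq_iff vec_eq_iff)

lemma real_point_sum: "real_point (sum f S) = (\<Sum>x\<in>S. real_point (f x))"
  by (induction S rule: infinite_finite_induct) (simp_all add: real_point_add)

lemma inj_real_vec: "inj real_vec"
  by (auto simp: inj_on_def real_vec_def vec_eq_iff)

lemma inj_real_point: "inj real_point"
  using inj_real_vec by (auto simp: inj_on_def real_point_def prod_eq_iff)

lemma fst_real_point [simp]: "fst (real_point p) = of_int (fst p)"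
  by (simp add: real_point_def)

lemma snd_real_point [simp]: "snd (real_point p) = real_vec (snd p)"
  by (simp add: real_point_def)

lemma finite_real_vec_bounded: "finite {x :: int ^ 'n. norm (real_vec x) \<le> R}"
proof -
  let ?S = "{-\<lceil>R\<rceil>..\<lceil>R\<rceil>}"
  have "vec_nth ` {x :: int ^ 'n. norm (real_vec x) \<le> R} \<subseteq> (UNIV :: 'n set) \<rightarrow>\<^sub>E ?S"
  proof (clarsimp simp: PiE_UNIV_domain)
    fix x :: "int ^ 'n" and i
    assume "norm (real_vec x) \<le> R"
    then have "\<bar>real_vec x $ i\<bar> \<le> R"
      using component_le_norm_cart[of "real_vec x" i] by linarith
    then have "\<bar>real_of_int (x $ i)\<bar> \<le> R"
      by (simp add: real_vec_def)
    then show "- \<lceil>R\<rceil> \<le> x $ i \<and> x $ i \<le> \<lceil>R\<rceil>"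
      by linarith
  qed
  then have "finite (vec_nth ` {x :: int ^ 'n. norm (real_vec x) \<le> R})"
    by (rule finite_subset) (simp add: finite_PiE)
  then show ?thesis
    by (rule finite_imageD) (simp add: inj_on_def vec_nth_inject)
qed

lemma finite_real_point_bounded: "finite {p :: int \<times> (int ^ 'n). norm (real_point p) \<le> R}"
proof (rule finite_subset)
  show "{p :: int \<times> (int ^ 'n). norm (real_point p) \<le> R}
    \<subseteq> {-\<lceil>R\<rceil>..\<lceil>R\<rceil>} \<times> {x. norm (real_vec x) \<le> R}"
  proof clarsimp
    fix a and b :: "int ^ 'n"
    assume "norm (real_point (a, b)) \<le> R"
    then have "\<bar>real_of_int a\<bar> \<le> R" "norm (real_vec b) \<le> R"
      using norm_fst_le[of "real_of_int a" "real_vec b"] norm_snd_le[of "real_vec b" "real_of_int a"]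
      by (auto simp: real_point_def)
    then show "- \<lceil>R\<rceil> \<le> a \<and> a \<le> \<lceil>R\<rceil> \<and> norm (real_vec b) \<le> R"
      by linarith
  qed
qed (simp add: finite_real_vec_bounded)

section \<open>Subgroups, submonoids and generated groups\<close>

lemma add_subgroup_group_closure: "add_subgroup (group_closure S)"
  by (auto simp: add_subgroup_def group_closure_add)

lemma subset_group_closure: "S \<subseteq> group_closure S"
  by (auto intro: group_closure.base)

lemma add_subgroup_diff: "add_subgroup H \<Longrightarrow> x \<in> H \<Longrightarrow> y \<in> H \<Longrightarrow> x - y \<in> H"
  unfolding add_subgroup_def by (metis uminus_add_conv_diff add.commute)

lemma group_closure_subset:
  assumes "S \<subseteq> H" "add_subgroup H"
  shows "group_closure S \<subseteq> H"
proof
  fix x assume "x \<in> group_closure S"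
  then show "x \<in> H"
    using assms by induction (auto simp: add_subgroup_diff add_subgroup_def)
qed

text \<open>Stated for submonoids so that it serves subgroups as well as \<open>insert 0 G\<close>,
  where \<open>G\<close> is a semigroup that may lack 0.\<close>

lemma zscale_mem_submonoid:
  assumes "0 \<in> S" "\<And>x y. x \<in> S \<Longrightarrow> y \<in> S \<Longrightarrow> x + y \<in> S" "p \<in> S" "0 \<le> k"
  shows "zscale k p \<in> S"
  using \<open>0 \<le> k\<close>
proof (induction k rule: int_ge_induct)
  case (step i)
  then show ?case
    using assms(2)[OF step.IH assms(3)] by (simp add: zscale_add_left)
qed (simp add: assms)

lemma sum_mem_submonoid:
  fixes S :: "'a::comm_monoid_add set"
  assumes "0 \<in> S" "\<And>x y. x \<in> S \<Longrightarrow> y \<in> S \<Longrightarrow> x + y \<in> S" "\<And>i. i \<in> I \<Longrightarrow> f i \<in> S"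
  shows "sum f I \<in> S"
  using assms(3) by (induction I rule: infinite_finite_induct) (auto simp: assms)

lemma zscale_mem_subgroup:
  assumes "add_subgroup H" "p \<in> H"
  shows "zscale k p \<in> H"
proof -
  have "zscale (int m) p \<in> H" for m
    using assms by (intro zscale_mem_submonoid) (auto simp: add_subgroup_def)
  then show ?thesis
    using assms by (cases k rule: int_cases2) (auto simp: zscale_minus_left add_subgroup_def)
qed

text \<open>Differences already form a group: (g - h) - (g' - h') = (g + h') - (h + g'), while s =
  (s + a) - a and 0 = a - a provide the generators and 0.\<close>

lemma group_closure_semigroup_diff:
  assumes "\<And>p q. p \<in> G \<Longrightarrow> q \<in> G \<Longrightarrow> p + q \<in> G" "G \<noteq> {}" "x \<in> group_closure G"
  shows "\<exists>g\<in>G. \<exists>h\<in>G. x = g - h"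
  using assms(3)
proof induction
  case (base s)
  obtain a where "a \<in> G" using assms(2) by auto
  then show ?case
    using base assms(1)[of s a] by (metis add_diff_cancel_right' diff_self insert_iff)
next
  case (diff s t)
  then obtain g h g' h' where "g \<in> G" "h \<in> G" "g' \<in> G" "h' \<in> G" "s = g - h" "t = g' - h'"
    by blast
  then have "s - t = (g + h') - (h + g')" "g + h' \<in> G" "h + g' \<in> G"
    using assms(1) by auto
  then show ?case by blast
qed

section \<open>Finitely generated cones and the conductor\<close>

text \<open>This is the generated cone only for finite \<open>P\<close>. For infinite
  \<open>P\<close> the sum defaults to 0, so the cone over an arbitrary set is later built as a
  union over finite subsets.\<close>

definition fcone :: "(int \<times> (int ^ 'n)) set \<Rightarrow> (real \<times> (real ^ 'n)) set" where
  "fcone P = {\<Sum>p\<in>P. t p *\<^sub>R real_point p |t. \<forall>p\<in>P. 0 \<le> t p}"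

lemma fcone_scaleR: "x \<in> fcone P \<Longrightarrow> 0 \<le> c \<Longrightarrow> c *\<^sub>R x \<in> fcone P"
  unfolding fcone_def by (auto simp: scaleR_sum_right)

lemma fcone_add:
  assumes "x \<in> fcone P" "y \<in> fcone P"
  shows "x + y \<in> fcone P"
proof -
  obtain s t where "\<forall>p\<in>P. 0 \<le> s p" "\<forall>p\<in>P. 0 \<le> t p"
      "x = (\<Sum>p\<in>P. s p *\<^sub>R real_point p)" "y = (\<Sum>p\<in>P. t p *\<^sub>R real_point p)"
    using assms unfolding fcone_def by blast
  then show ?thesis
    unfolding fcone_def
    by (intro CollectI exI[of _ "\<lambda>p. s p + t p"]) (auto simp: sum.distrib scaleR_left_distrib)
qed

lemma convex_fcone: "convex (fcone P)"
  by (intro convexI fcone_add fcone_scaleR) auto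

lemma real_point_in_fcone:
  assumes "finite P" "p \<in> P"
  shows "real_point p \<in> fcone P"
proof -
  have "(\<Sum>q\<in>P. (if q = p then 1 else 0) *\<^sub>R real_point q) = real_point p"
    using assms by (simp add: if_distrib[of "\<lambda>c. c *\<^sub>R _"] cong: if_cong)
  then show ?thesis
    unfolding fcone_def by (intro CollectI exI[of _ "\<lambda>q. if q = p then 1 else 0"]) auto
qed

lemma fcone_mono:
  assumes "finite Q" "P \<subseteq> Q"
  shows "fcone P \<subseteq> fcone Q"
proof
  fix x assume "x \<in> fcone P"
  then obtain t where t: "\<forall>p\<in>P. 0 \<le> t p" "x = (\<Sum>p\<in>P. t p *\<^sub>R real_point p)"
    unfolding fcone_def by blast
  have "x = (\<Sum>p\<in>Q. (if p \<in> P then t p else 0) *\<^sub>R real_point p)"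
    unfolding t(2) using assms by (intro sum.mono_neutral_cong_left) auto
  then show "x \<in> fcone Q"
    unfolding fcone_def using t(1) by (intro CollectI exI[of _ "\<lambda>p. if p \<in> P then t p else 0"]) auto
qed

text \<open>Khovanskii's conductor: modulo the nonnegative integer combinations of \<open>P\<close>, a lattice point
  of the cone is one of finitely many points \<open>w\<close>, and each \<open>w\<close> is a difference of elements of \<open>G\<close>.\<close>

lemma conductor_exists:
  assumes G: "\<And>p q. p \<in> G \<Longrightarrow> q \<in> G \<Longrightarrow> p + q \<in> G" and ne: "G \<noteq> {}"
    and P: "finite P" "P \<subseteq> G"
  obtains z where "z \<in> G"
    "\<And>x. x \<in> group_closure G \<Longrightarrow> real_point x - real_point z \<in> fcone P \<Longrightarrow> x \<in> G"
proof -
  let ?L = "group_closure G"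
  \<comment> \<open>The bound admits every lattice combination of \<open>P\<close> with coefficients
    in [0, 1), hence every remainder left after rounding the coefficients down.\<close>
  define W where "W = {w \<in> ?L. norm (real_point w) \<le> (\<Sum>p\<in>P. norm (real_point p))}"
  have finW: "finite W"
    unfolding W_def by (rule finite_subset[OF _ finite_real_point_bounded]) auto
  have "\<exists>g\<in>G. g - w \<in> G" if "w \<in> W" for w
  proof -
    have "w \<in> ?L" using that by (simp add: W_def)
    from group_closure_semigroup_diff[OF G ne this] obtain g h where "g \<in> G" "h \<in> G" "w = g - h"
      by blast
    then show ?thesis by (intro bexI[of _ g]) auto
  qed
  then have "\<forall>w\<in>W. \<exists>g. g \<in> G \<and> g - w \<in> G" by blast
  from bchoice[OF this] obtain g where g: "\<And>w. w \<in> W \<Longrightarrow> g w \<in> G" "\<And>w. w \<in> W \<Longrightarrow> g w - w \<in> G"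
    by blast
  define h where "h w = g w - w" for w
  have gh: "\<And>w. w \<in> W \<Longrightarrow> g w \<in> G" "\<And>w. w \<in> W \<Longrightarrow> h w \<in> G"
    using g by (auto simp: h_def)
  obtain a where a: "a \<in> G" using ne by auto
  \<comment> \<open>One \<open>z\<close> serves all remainders: in \<open>w + z\<close> the summand
    \<open>h w\<close> turns \<open>w\<close> into \<open>g w\<close>, and the other summands stay
    in \<open>insert 0 G\<close>. The summand \<open>a\<close> puts \<open>z\<close> into
    \<open>G\<close> itself.\<close>
  define z where "z = a + (\<Sum>w\<in>W. h w)"
  have G0: "x + y \<in> insert 0 G" if "x \<in> insert 0 G" "y \<in> insert 0 G" for x y
    using that G[of x y] by auto
  have G1: "x + y \<in> G" if "x \<in> G" "y \<in> insert 0 G" for x y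
    using that G[of x y] by auto
  note monoid = insertI1[of 0 G] G0
  have zG: "z \<in> G"
    unfolding z_def using gh(2) by (intro G1[OF a] sum_mem_submonoid[OF monoid]) auto
  have "x \<in> G" if x: "x \<in> ?L" "real_point x - real_point z \<in> fcone P" for x
  proof -
    obtain t where t: "\<forall>p\<in>P. 0 \<le> t p" "real_point x - real_point z = (\<Sum>p\<in>P. t p *\<^sub>R real_point p)"
      using x unfolding fcone_def by blast
    define y where "y = (\<Sum>p\<in>P. zscale \<lfloor>t p\<rfloor> p)"
    have y: "y \<in> insert 0 G"
      unfolding y_def using P(2) t(1)
      by (intro sum_mem_submonoid[OF monoid] zscale_mem_submonoid[OF monoid]) auto
    define w where "w = x - z - y"
    have "w \<in> ?L"
      unfolding w_def using x(1) y zG subset_group_closure[of G]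
      by (intro add_subgroup_diff add_subgroup_group_closure) auto
    moreover have "real_point w = (\<Sum>p\<in>P. frac (t p) *\<^sub>R real_point p)"
      by (simp add: w_def y_def real_point_diff t(2) real_point_sum real_point_zscale frac_def
          scaleR_left_diff_distrib sum_subtractf)
    then have "norm (real_point w) \<le> (\<Sum>p\<in>P. norm (real_point p))"
      by (auto intro!: sum_norm_le mult_left_le_one_le
          simp: frac_ge_0 abs_of_nonneg order_less_imp_le[OF frac_lt_1])
    ultimately have w: "w \<in> W" by (simp add: W_def)
    have "(\<Sum>v\<in>W - {w}. h v) \<in> insert 0 G"
      using gh(2) by (intro sum_mem_submonoid[OF monoid]) auto
    then have "y + (a + (\<Sum>v\<in>W - {w}. h v)) \<in> insert 0 G"
      using a y by (intro G0) auto
    then have "g w + (y + (a + (\<Sum>v\<in>W - {w}. h v))) \<in> G"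
      by (rule G1[OF gh(1)[OF w]])
    moreover have "x = w + (a + (\<Sum>v\<in>W. h v)) + y"
      by (simp add: w_def z_def)
    then have "x = g w + (y + (a + (\<Sum>v\<in>W - {w}. h v)))"
      unfolding sum.remove[OF finW w, of h] by (simp add: h_def)
    ultimately show ?thesis by simp
  qed
  with zG that show thesis by blast
qed

section \<open>Low degrees and full rank of a graded semigroup\<close>

lemma graded_semigroup_add: "graded_semigroup G \<Longrightarrow> p \<in> G \<Longrightarrow> q \<in> G \<Longrightarrow> p + q \<in> G"
  unfolding graded_semigroup_def by blast

lemma graded_semigroup_degree_1:
  assumes "graded_semigroup G"
  obtains a where "a \<in> G" "fst a = 1"
proof -
  have "slice 1 G \<noteq> {}"
    using assms by (simp add: graded_semigroup_def)
  then obtain x where "(1, x) \<in> G"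
    by (auto simp: slice_def)
  then show thesis
    using that[of "(1, x)"] by simp
qed

text \<open>Adding multiples of a nonzero element of degree 0 to an element of degree 1 would
  produce infinitely many elements of degree 1.\<close>

lemma graded_semigroup_degree_0:
  assumes G: "graded_semigroup G" and "finite_sections G" "p \<in> G" "fst p = 0"
  shows "p = 0"
proof (rule ccontr)
  assume "p \<noteq> 0"
  then obtain i where i: "snd p $ i \<noteq> 0"
    using \<open>fst p = 0\<close> by (auto simp: prod_eq_iff vec_eq_iff)
  obtain a where a: "a \<in> G" "fst a = 1"
    using graded_semigroup_degree_1[OF G] .
  have "a + zscale (int k) p \<in> G" for k
  proof (induction k)
    case (Suc k)
    have "a + zscale (int (Suc k)) p = (a + zscale (int k) p) + p"
      by (simp add: zscale_add_left add_ac)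
    moreover have "\<dots> \<in> G"
      using Suc \<open>p \<in> G\<close> by (rule graded_semigroup_add[OF G])
    ultimately show ?case
      by (simp only:)
  qed (simp add: a)
  then have "range (\<lambda>k. snd (a + zscale (int k) p)) \<subseteq> slice 1 G"
    using a(2) \<open>fst p = 0\<close> unfolding slice_def
    by (auto simp: zscale_def plus_prod_def)
  then have "finite (range (\<lambda>k. snd (a + zscale (int k) p)))"
    using \<open>finite_sections G\<close> finite_subset unfolding finite_sections_def by (metis zero_less_one)
  moreover have "inj (\<lambda>k. snd (a + zscale (int k) p))"
    using i by (auto simp: inj_on_def zscale_def vec_eq_iff)
  ultimately show False
    using finite_imageD infinite_UNIV_nat by blast
qed

text \<open>Pigeonhole: two different multiples of \<open>x\<close> lie in the same coset of
  \<open>H\<close>, and their difference is again a multiple.\<close>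

lemma finite_index_multiple:
  fixes H :: "(int \<times> (int ^ 'n)) set"
  assumes H: "finite_index H" "add_subgroup H"
  shows "\<exists>k>0. zscale k x \<in> H"
proof -
  let ?f = "\<lambda>k::nat. (+) (zscale (int k) x) ` H"
  have "range ?f \<subseteq> range (\<lambda>x. (+) x ` H)" by auto
  then have "finite (range ?f)"
    using H(1) finite_subset unfolding finite_index_def by blast
  then have "\<not> inj ?f"
    using finite_imageD infinite_UNIV_nat by blast
  then obtain k l where kl: "k < l" "?f k = ?f l"
    unfolding inj_on_def by (metis linorder_neqE_nat)
  have "zscale (int l) x \<in> ?f l"
    using H(2) unfolding add_subgroup_def by (intro image_eqI[of _ _ 0]) auto
  then obtain h where h: "h \<in> H" "zscale (int l) x = zscale (int k) x + h"
    using kl(2) by blast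
  have "zscale (int l) x = zscale (int k) x + zscale (int l - int k) x"
    by (simp flip: zscale_add_left)
  then have "zscale (int l - int k) x \<in> H"
    using h by simp
  then show ?thesis
    using kl(1) by (intro exI[of _ "int l - int k"]) auto
qed

text \<open>A positive multiple of every lattice point lies in the generated group, so dividing by
  it puts all lattice points into the span, among them the standard basis.\<close>

lemma complete_rank_span:
  fixes G :: "(int \<times> (int ^ 'n)) set"
  assumes "complete_rank G"
  shows "span (real_point ` G) = UNIV"
proof -
  let ?V = "span (real_point ` G)"
  have closure: "real_point x \<in> ?V" if "x \<in> group_closure G" for x
    using that by induction (auto simp: span_base span_zero real_point_diff span_diff)
  have point: "real_point x \<in> ?V" for x
  proof -
    obtain k where k: "k > 0" "zscale k x \<in> group_closure G"
      using finite_index_multiple[of "group_closure G" x] assms add_subgroup_group_closure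
      unfolding complete_rank_def by blast
    have "(1 / real_of_int k) *\<^sub>R real_point (zscale k x) \<in> ?V"
      using closure[OF k(2)] by (rule span_mul)
    then show ?thesis
      using k(1) by (simp add: real_point_zscale)
  qed
  have "b \<in> ?V" if "b \<in> Basis" for b :: "real \<times> (real ^ 'n)"
  proof -
    from that consider "b = (1, 0)" | i where "b = (0, axis i 1)"
      by (auto simp: Basis_prod_def Basis_vec_def)
    then show ?thesis
    proof cases
      case 1
      then have "b = real_point (1, 0)"
        by (simp add: real_point_def real_vec_def vec_eq_iff)
      then show ?thesis using point by simp
    next
      case 2
      then have "b = real_point (0, axis i 1)"
        by (auto simp: real_point_def real_vec_def vec_eq_iff axis_def)
      then show ?thesis using point by simp
    qed
  qed
  then have "span Basis \<subseteq> ?V"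
    by (intro span_minimal) auto
  then show ?thesis
    unfolding span_Basis by (rule top.extremum_uniqueI)
qed

section \<open>Limited growth forces a linear bound\<close>

text \<open>The elements \<open>a0 p0 + j u + (\<Sum>p. a p p)\<close> with \<open>0 \<le> a0 < k = \<lceil>- c p0\<rceil>\<close> are
  distinct, since \<open>j\<close> and \<open>a0\<close> are quotient and remainder of the \<open>p0\<close>-coordinate.
  There are \<open>k k N\<^sup>n\<close> of them with \<open>N = k h(u)\<close>, in degrees up to a constant multiple of \<open>N\<close>.\<close>

lemma coordinate_lower_bound:
  fixes G :: "(int \<times> (int ^ 'n)) set" and q :: real
  assumes G: "\<And>p q. p \<in> G \<Longrightarrow> q \<in> G \<Longrightarrow> p + q \<in> G"
    and fin: "finite_sections G"
    and q: "\<And>d. d > 0 \<Longrightarrow> real (card (slice d G)) < q * real_of_int d ^ CARD('n)"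
    and P: "finite P" "P \<subseteq> G" "card P = CARD('n) + 1"
    and indep: "\<And>c. (\<Sum>p\<in>P. c p *\<^sub>R real_point p) = 0 \<Longrightarrow> \<forall>p\<in>P. c p = 0"
    and deg: "\<And>p. p \<in> P \<Longrightarrow> fst p > 0"
    and u: "u \<in> G" "fst u > 0" "real_point u = (\<Sum>p\<in>P. c p *\<^sub>R real_point p)"
    and p0: "p0 \<in> P"
  shows "- c p0 \<le> q * (2 * real_of_int (\<Sum>p\<in>P. fst p) + 1) ^ (CARD('n) + 1) * real_of_int (fst u)"
proof (cases "c p0 < 0")
  case False
  have "0 < q" using q[of 1] by simp
  moreover have "0 \<le> (\<Sum>p\<in>P. fst p)" using deg by (force intro: sum_nonneg)
  then have "0 \<le> 2 * real_of_int (\<Sum>p\<in>P. fst p) + 1" by linarith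
  ultimately have "0 \<le> q * (2 * real_of_int (\<Sum>p\<in>P. fst p) + 1) ^ (CARD('n) + 1) * real_of_int (fst u)"
    using u(2) by (intro mult_nonneg_nonneg zero_le_power) simp_all
  then show ?thesis using False by linarith
next
  case True
  define n where "n = CARD('n)"
  define m where "m = fst u"
  define s where "s = (\<Sum>p\<in>P. fst p)"
  define k where "k = \<lceil>- c p0\<rceil>"
  define N where "N = k * m"
  \<comment> \<open>The term in \<open>p0\<close> and the sum over \<open>P'\<close> each have
    degree at most \<open>N * s\<close>, and \<open>j u\<close> has degree at most
    \<open>k * m = N\<close>.\<close>
  define D where "D = (2 * s + 1) * N"
  define P' where "P' = P - {p0}"
  define I where "I = {0..<k} \<times> {1..k} \<times> (P' \<rightarrow>\<^sub>E {0..<N})"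
  define F where "F = (\<lambda>(a0, j, a). zscale a0 p0 + zscale j u + (\<Sum>p\<in>P'. zscale (a p) p))"
  have m: "m \<ge> 1" using u(2) by (simp add: m_def)
  have k: "k \<ge> 1" using True by (simp add: k_def)
  have N: "N \<ge> k" using m k by (simp add: N_def)
  have P': "finite P'" "P' \<subseteq> P" "p0 \<notin> P'" "card P' = n"
    using P p0 by (auto simp: P'_def n_def)
  have sP': "fst p0 + (\<Sum>p\<in>P'. fst p) = s"
    using sum.remove[OF P(1) p0, of fst] by (simp add: s_def P'_def)
  have "(\<Sum>p\<in>P'. fst p) \<ge> 0"
    using P'(2) deg by (force intro: sum_nonneg)
  then have s: "fst p0 \<le> s" "(\<Sum>p\<in>P'. fst p) \<le> s" "0 \<le> s"
    using sP' deg[OF p0] by linarith+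
  have coord: "real_point (F (a0, j, a)) = (\<Sum>p\<in>P. ((if p = p0 then real_of_int a0 else real_of_int (a p)) + real_of_int j * c p) *\<^sub>R real_point p)"
    for a0 j a
    unfolding F_def using P'(3)
    by (simp add: real_point_add real_point_sum real_point_zscale u(3) scaleR_left_distrib sum.distrib
        scaleR_sum_right scaleR_right_distrib sum.remove[OF P(1) p0] P'_def)
  have inj: "inj_on F I"
  proof (rule inj_onI)
    fix x y assume xy: "x \<in> I" "y \<in> I" "F x = F y"
    obtain a0 j a where x: "x = (a0, j, a)" by (cases x)
    obtain b0 l b where y: "y = (b0, l, b)" by (cases y)
    let ?e = "\<lambda>p. (if p = p0 then real_of_int a0 else real_of_int (a p)) + real_of_int j * c p
      - ((if p = p0 then real_of_int b0 else real_of_int (b p)) + real_of_int l * c p)"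
    have "(\<Sum>p\<in>P. ?e p *\<^sub>R real_point p) = real_point (F x) - real_point (F y)"
      unfolding x y coord by (simp only: scaleR_left_diff_distrib sum_subtractf)
    then have "\<forall>p\<in>P. ?e p = 0"
      using xy(3) by (intro indep) simp
    then have e: "?e p = 0" if "p \<in> P" for p
      using that by blast
    have ab: "0 \<le> a0" "a0 < k" "0 \<le> b0" "b0 < k"
      using xy x y by (auto simp: I_def)
    \<comment> \<open>By integrality, an integer below the ceiling of \<open>- c p0\<close> is below
      \<open>- c p0\<close> itself. So \<open>a0\<close> and \<open>b0\<close> differ by less than
      \<open>- c p0\<close>, whereas \<open>j \<noteq> l\<close> would force a difference of at
      least that size.\<close>
    then have ab': "real_of_int a0 < - c p0" "real_of_int b0 < - c p0"
      unfolding k_def by linarith+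
    have "j = l"
    proof (rule ccontr)
      assume "j \<noteq> l"
      then have "1 \<le> \<bar>real_of_int j - real_of_int l\<bar>" by linarith
      then have "- c p0 \<le> \<bar>real_of_int j - real_of_int l\<bar> * - c p0"
        using True mult_right_mono[of 1 _ "- c p0"] by force
      also have "\<dots> = \<bar>(real_of_int j - real_of_int l) * c p0\<bar>"
        using True by (simp add: abs_mult)
      also have "(real_of_int j - real_of_int l) * c p0 = real_of_int b0 - real_of_int a0"
        using e[OF p0] by (simp add: algebra_simps)
      finally show False
        using ab ab' by linarith
    qed
    moreover have "a0 = b0"
      using e[OF p0] \<open>j = l\<close> by simp
    moreover have "a = b"
    proof (rule PiE_ext)
      show "a \<in> P' \<rightarrow>\<^sub>E {0..<N}" "b \<in> P' \<rightarrow>\<^sub>E {0..<N}"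
        using xy x y by (auto simp: I_def)
      fix p assume "p \<in> P'"
      then have "p \<in> P" "p \<noteq> p0" using P' by auto
      with e[of p] \<open>j = l\<close> show "a p = b p" by simp
    qed
    ultimately show "x = y" using x y by simp
  qed
  have image: "F ` I \<subseteq> (SIGMA d:{1..D}. slice d G)"
  proof clarify
    fix d v a0 j a
    assume F: "(d, v) = F (a0, j, a)" and "(a0, j, a) \<in> I"
    then have i: "0 \<le> a0" "a0 < k" "1 \<le> j" "j \<le> k" "\<And>p. p \<in> P' \<Longrightarrow> 0 \<le> a p" "\<And>p. p \<in> P' \<Longrightarrow> a p < N"
      by (auto simp: I_def PiE_iff)
    have G0: "x + y \<in> insert 0 G" if "x \<in> insert 0 G" "y \<in> insert 0 G" for x y
      using that G[of x y] by auto
    note monoid = insertI1[of 0 G] G0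
    have z: "F (a0, j, a) \<in> insert 0 G"
      unfolding F_def case_prod_conv using i u(1) P(2) p0 P'
      by (intro G0 sum_mem_submonoid[OF monoid] zscale_mem_submonoid[OF monoid]) auto
    have d: "d = a0 * fst p0 + j * m + (\<Sum>p\<in>P'. a p * fst p)"
      using arg_cong[OF F, of fst] by (simp add: F_def fst_sum m_def)
    have nn: "0 \<le> a0 * fst p0" "0 \<le> (\<Sum>p\<in>P'. a p * fst p)" "m \<le> j * m" "j * m \<le> N"
      using i deg[OF p0] m deg P'(2) by (auto intro!: sum_nonneg mult_nonneg_nonneg simp: N_def less_imp_le mult_right_mono)
    \<comment> \<open>Here it matters that \<open>j\<close> starts at 1: positive degree rules out
      the value 0 that \<open>insert 0 G\<close> allows.\<close>
    then have "1 \<le> d" using d m by linarith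
    have "a0 * fst p0 \<le> N * s"
      using i N s deg[OF p0] by (intro mult_mono) auto
    moreover have "(\<Sum>p\<in>P'. a p * fst p) \<le> (\<Sum>p\<in>P'. N * fst p)"
      using i(6) deg P'(2) by (intro sum_mono mult_right_mono) (auto simp: less_imp_le subset_eq)
    then have "(\<Sum>p\<in>P'. a p * fst p) \<le> N * s"
      using mult_left_mono[OF s(2), of N] N k by (simp add: sum_distrib_left)
    ultimately have "d \<le> D"
      using d nn(4) by (simp add: D_def algebra_simps)
    moreover have "(d, v) \<in> G"
      using z \<open>1 \<le> d\<close> F by (auto simp: zero_prod_def)
    ultimately show "d \<in> {1..D} \<and> v \<in> slice d G"
      using \<open>1 \<le> d\<close> by (simp add: slice_def)
  qed
  have finG: "finite (slice d G)" if "d \<in> {1..D}" for d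
    using fin that by (simp add: finite_sections_def)
  have D: "D \<ge> 1" using s N k unfolding D_def by (smt (verit) mult_less_cancel_right2)
  have q0: "0 < q" using q[of 1] by simp
  have "card I = nat k * (nat k * nat N ^ n)"
    using P' k by (simp add: I_def card_cartesian_product card_PiE)
  then have "real_of_int k * (real_of_int k * real_of_int N ^ n) = real (card I)"
    using k N by simp
  also have "\<dots> = real (card (F ` I))"
    by (simp add: card_image[OF inj])
  also have "\<dots> \<le> real (card (SIGMA d:{1..D}. slice d G))"
    using image finG by (intro of_nat_mono card_mono finite_SigmaI) auto
  also have "\<dots> = (\<Sum>d\<in>{1..D}. real (card (slice d G)))"
    using finG by (subst card_SigmaI) auto
  also have "\<dots> \<le> (\<Sum>d\<in>{1..D}. q * real_of_int D ^ n)"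
  proof (rule sum_mono)
    fix d assume d: "d \<in> {1..D}"
    then have "real (card (slice d G)) < q * real_of_int d ^ n"
      using q[of d] by (simp add: n_def)
    also have "\<dots> \<le> q * real_of_int D ^ n"
      using d q0 by (intro mult_left_mono power_mono) auto
    finally show "real (card (slice d G)) \<le> q * real_of_int D ^ n" by simp
  qed
  also have "\<dots> = q * real_of_int D ^ (n + 1)"
    using D by simp
  also have "\<dots> = q * (2 * real_of_int s + 1) ^ (n + 1) * real_of_int N ^ (n + 1)"
    by (simp add: D_def power_mult_distrib)
  \<comment> \<open>One factor \<open>N\<close> is split as \<open>k * m\<close>. After cancelling
    \<open>k * N ^ n\<close>, a bound on \<open>k\<close> that is linear in \<open>m\<close>
    remains.\<close>
  also have "\<dots> = (real_of_int k * real_of_int N ^ n) * (q * (2 * real_of_int s + 1) ^ (n + 1) * real_of_int m)"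
    by (simp add: N_def)
  finally have "(real_of_int k * real_of_int N ^ n) * real_of_int k
    \<le> (real_of_int k * real_of_int N ^ n) * (q * (2 * real_of_int s + 1) ^ (n + 1) * real_of_int m)"
    by (simp add: mult_ac)
  moreover have "0 < real_of_int k * real_of_int N ^ n"
    using k N by simp
  ultimately have "real_of_int k \<le> q * (2 * real_of_int s + 1) ^ (n + 1) * real_of_int m"
    by (rule mult_left_le_imp_le)
  then show ?thesis
    unfolding k_def s_def n_def m_def by linarith
qed

text \<open>Take coordinates with respect to a basis \<open>P\<close> of elements of
  \<open>G\<close>. They are bounded below by a multiple of the degree, and the degree is their
  combination with positive weights \<open>fst p\<close>, so they are bounded above in the same
  way.\<close>

lemma limited_growth_bounded:
  fixes G :: "(int \<times> (int ^ 'n)) set"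
  assumes G: "graded_semigroup G" "complete_rank G" "limited_growth G"
  obtains R where "0 \<le> R" "\<And>p. p \<in> G \<Longrightarrow> norm (real_vec (snd p)) \<le> R * real_of_int (fst p)"
proof -
  note add = graded_semigroup_add[OF G(1)]
  have nonneg: "0 \<le> fst p" if "p \<in> G" for p
    using G(1) that unfolding graded_semigroup_def by blast
  obtain q where fin: "finite_sections G"
    and q: "\<And>d. d > 0 \<Longrightarrow> real (card (slice d G)) < q * real_of_int d ^ CARD('n)"
    using G(3) unfolding limited_growth_def by blast
  obtain B where B: "B \<subseteq> real_point ` G" "independent B" "real_point ` G \<subseteq> span B" "card B = dim (real_point ` G)"
    by (rule basis_exists)
  have spanB: "span B = UNIV"
    using span_mono[OF B(3)] complete_rank_span[OF G(2)] by (simp add: span_span top.extremum_unique)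
  have finB: "finite B"
    using B(2) by (rule finiteI_independent)
  define P where "P = real_point -` B"
  have imP: "real_point ` P = B"
    using B(1) unfolding P_def by auto
  have PG: "P \<subseteq> G"
    using B(1) inj_image_mem_iff[OF inj_real_point] unfolding P_def by blast
  have finP: "finite P"
    unfolding P_def using finB inj_real_point by (intro finite_vimageI)
  have inj: "inj_on real_point P"
    using inj_real_point by (rule inj_on_subset) simp
  have cardP: "card P = CARD('n) + 1"
    using card_image[OF inj] B(4) dim_eq_full[of "real_point ` G"] complete_rank_span[OF G(2)]
    by (simp add: imP)
  have indep: "\<forall>p\<in>P. c p = 0" if "(\<Sum>p\<in>P. c p *\<^sub>R real_point p) = 0" for c
  proof -
    have "(\<Sum>b\<in>B. c (the_inv_into P real_point b) *\<^sub>R b) = 0"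
      using that by (simp add: imP[symmetric] sum.reindex[OF inj] the_inv_into_f_f[OF inj])
    then have "\<forall>b\<in>B. c (the_inv_into P real_point b) = 0"
      using B(2) finB independent_explicit by (metis (no_types))
    then show ?thesis
      using the_inv_into_f_f[OF inj] by (simp add: imP[symmetric])
  qed
  have deg: "fst p > 0" if "p \<in> P" for p
  proof -
    have "p \<noteq> 0"
      using that B(2) dependent_zero unfolding P_def by force
    then have "fst p \<noteq> 0"
      using graded_semigroup_degree_0[OF G(1) fin] that PG by blast
    then show ?thesis
      using nonneg[of p] that PG by fastforce
  qed
  define s where "s = (\<Sum>p\<in>P. fst p)"
  define Q where "Q = q * (2 * real_of_int s + 1) ^ (CARD('n) + 1)"
  have s: "0 \<le> s"
    unfolding s_def using deg by (force intro: sum_nonneg)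
  have "0 < q" using q[of 1] by simp
  then have Q: "0 \<le> Q"
    unfolding Q_def using s by (intro mult_nonneg_nonneg zero_le_power) auto
  \<comment> \<open>Per unit of degree, a coordinate is at most \<open>1 + Q * s\<close> and at
    least \<open>- Q\<close>; the sum of the two constants bounds its absolute value.\<close>
  define R where "R = (\<Sum>p\<in>P. (1 + Q * s + Q) * norm (real_point p))"
  have "norm (real_vec (snd u)) \<le> R * real_of_int (fst u)" if u: "u \<in> G" for u
  proof (cases "fst u = 0")
    case True
    then have "u = 0" using graded_semigroup_degree_0[OF G(1) fin u] by simp
    then show ?thesis by (simp add: real_vec_def zero_vec_def[symmetric])
  next
    case False
    with nonneg[OF u] have m: "fst u > 0" by simp
    have "real_point u \<in> span (real_point ` P)"
      by (simp add: imP spanB)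
    then obtain c' where "real_point u = (\<Sum>b\<in>B. c' b *\<^sub>R b)"
      using span_finite[OF finB] imP by auto
    then obtain c where c: "real_point u = (\<Sum>p\<in>P. c p *\<^sub>R real_point p)"
      using that[of "\<lambda>p. c' (real_point p)"] by (simp add: imP[symmetric] sum.reindex[OF inj])
    have lower: "- c p \<le> Q * real_of_int (fst u)" if "p \<in> P" for p
      using coordinate_lower_bound[OF add fin q finP PG cardP indep deg u m c that]
      by (simp add: Q_def s_def)
    have upper: "\<bar>c p\<bar> \<le> (1 + Q * s + Q) * real_of_int (fst u)" if p: "p \<in> P" for p
    proof -
      have "real_of_int (fst u) = (\<Sum>p\<in>P. c p * real_of_int (fst p))"
        using arg_cong[OF c, of fst] by (simp add: fst_sum)
      also have "\<dots> = c p * real_of_int (fst p) + (\<Sum>p\<in>P - {p}. c p * real_of_int (fst p))"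
        by (rule sum.remove[OF finP p])
      finally have "c p * real_of_int (fst p) = real_of_int (fst u) + (\<Sum>p\<in>P - {p}. - c p * real_of_int (fst p))"
        by (simp add: sum_negf)
      also have "(\<Sum>p\<in>P - {p}. - c p * real_of_int (fst p)) \<le> (\<Sum>p\<in>P - {p}. Q * real_of_int (fst u) * real_of_int (fst p))"
        using lower deg by (intro sum_mono mult_right_mono) (auto simp: less_imp_le)
      also have "\<dots> = Q * real_of_int (fst u) * (\<Sum>p\<in>P - {p}. real_of_int (fst p))"
        by (simp add: sum_distrib_left)
      also have "\<dots> \<le> Q * real_of_int (fst u) * s"
      proof (rule mult_left_mono)
        have "(\<Sum>p\<in>P - {p}. fst p) \<le> s"
          using sum.remove[OF finP p, of fst] deg[OF p] by (simp add: s_def)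
        then show "(\<Sum>p\<in>P - {p}. real_of_int (fst p)) \<le> real_of_int s"
          by (metis of_int_le_iff of_int_sum)
      qed (use Q m in simp)
      finally have *: "c p * real_of_int (fst p) \<le> (1 + Q * s) * real_of_int (fst u)"
        by (simp add: algebra_simps)
      have nn: "0 \<le> (1 + Q * s) * real_of_int (fst u)" "0 \<le> Q * real_of_int (fst u)"
        using Q s m by auto
      have "c p \<le> (1 + Q * s) * real_of_int (fst u)"
      proof (cases "c p \<le> 0")
        case False
        then have "c p * 1 \<le> c p * real_of_int (fst p)"
          using deg[OF p] by (intro mult_left_mono) auto
        then show ?thesis using * by simp
      qed (use nn in linarith)
      then show ?thesis
        using lower[OF p] nn by (simp add: distrib_right abs_le_iff)
    qed
    have "norm (real_vec (snd u)) \<le> norm (real_point u)"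
      using norm_snd_le[of "snd (real_point u)" "fst (real_point u)"] by (simp add: real_point_def)
    also have "\<dots> \<le> (\<Sum>p\<in>P. (1 + Q * s + Q) * real_of_int (fst u) * norm (real_point p))"
      unfolding c using upper by (intro sum_norm_le) (simp add: mult_right_mono)
    also have "\<dots> = R * real_of_int (fst u)"
      by (simp add: R_def sum_distrib_left sum_distrib_right mult_ac)
    finally show ?thesis .
  qed
  moreover have "0 \<le> R"
    unfolding R_def using Q s by (intro sum_nonneg) auto
  ultimately show thesis using that by blast
qed

section \<open>The convex cone over a semigroup\<close>

definition gcone :: "(int \<times> (int ^ 'n)) set \<Rightarrow> (real \<times> (real ^ 'n)) set" where
  "gcone G = \<Union>{fcone P |P. finite P \<and> P \<subseteq> G}"

lemma real_point_in_gcone: "p \<in> G \<Longrightarrow> real_point p \<in> gcone G"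
  unfolding gcone_def using real_point_in_fcone[of "{p}" p]
  by (intro UnionI[of "fcone {p}"]) auto

lemma zero_in_gcone: "0 \<in> gcone G"
proof -
  have "0 \<in> fcone {}" by (simp add: fcone_def)
  then show ?thesis unfolding gcone_def by blast
qed

lemma gcone_scaleR: "x \<in> gcone G \<Longrightarrow> 0 \<le> c \<Longrightarrow> c *\<^sub>R x \<in> gcone G"
  unfolding gcone_def using fcone_scaleR by blast

lemma gcone_add:
  assumes "x \<in> gcone G" "y \<in> gcone G"
  shows "x + y \<in> gcone G"
proof -
  obtain P Q where PQ: "finite P" "P \<subseteq> G" "x \<in> fcone P" "finite Q" "Q \<subseteq> G" "y \<in> fcone Q"
    using assms unfolding gcone_def by blast
  then have "x \<in> fcone (P \<union> Q)" "y \<in> fcone (P \<union> Q)"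
    using fcone_mono[of "P \<union> Q" P] fcone_mono[of "P \<union> Q" Q] by auto
  then have "x + y \<in> fcone (P \<union> Q)"
    by (rule fcone_add)
  moreover have "finite (P \<union> Q)" "P \<union> Q \<subseteq> G"
    using PQ by auto
  ultimately show ?thesis
    unfolding gcone_def by blast
qed

lemma convex_gcone: "convex (gcone G)"
  by (intro convexI gcone_add gcone_scaleR) auto

lemma cone_gcone: "cone (gcone G)"
  by (simp add: cone_def gcone_scaleR)

lemma gcone_minimal:
  assumes "real_point ` G \<subseteq> C" "convex C" "cone C" "0 \<in> C"
  shows "gcone G \<subseteq> C"
proof
  fix x assume "x \<in> gcone G"
  then obtain P t where P: "P \<subseteq> G" "\<forall>p\<in>P. 0 \<le> t p" "x = (\<Sum>p\<in>P. t p *\<^sub>R real_point p)"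
    unfolding gcone_def fcone_def by auto
  have add: "a + b \<in> C" if "a \<in> C" "b \<in> C" for a b
    using assms(2,3) that convex_cone by blast
  show "x \<in> C"
    unfolding P(3)
  proof (intro sum_mem_submonoid[OF assms(4) add])
    fix p assume "p \<in> P"
    then have "real_point p \<in> C" "0 \<le> t p"
      using P(1,2) assms(1) by blast+
    then show "t p *\<^sub>R real_point p \<in> C"
      using assms(3) unfolding cone_def by blast
  qed
qed

text \<open>A box around \<open>x\<close> inside the cone is the convex hull of finitely many
  points, each of which needs only finitely many generators. This reduces interior points to the
  finite situation of the conductor.\<close>

lemma interior_gcone_finite:
  assumes "x \<in> interior (gcone G)"
  obtains P where "finite P" "P \<subseteq> G" "x \<in> interior (fcone P)"
proof -
  obtain a b where ab: "cbox a b \<subseteq> interior (gcone G)" "x \<in> box a b"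
    using open_contains_cbox[OF open_interior assms] by metis
  obtain V where V: "finite V" "cbox a b = convex hull V"
    by (rule closed_interval_as_convex_hull)
  have "\<forall>v\<in>V. \<exists>P. finite P \<and> P \<subseteq> G \<and> v \<in> fcone P"
  proof
    fix v assume "v \<in> V"
    then have "v \<in> gcone G"
      using V(2) ab(1) hull_inc[of v V convex] interior_subset[of "gcone G"] by blast
    then show "\<exists>P. finite P \<and> P \<subseteq> G \<and> v \<in> fcone P"
      unfolding gcone_def by blast
  qed
  from bchoice[OF this] obtain P where P: "\<forall>v\<in>V. finite (P v) \<and> P v \<subseteq> G \<and> v \<in> fcone (P v)"
    by blast
  define Q where "Q = (\<Union>v\<in>V. P v)"
  have Q: "finite Q" "Q \<subseteq> G"
    using P V(1) by (auto simp: Q_def)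
  have "V \<subseteq> fcone Q"
    using P fcone_mono[OF Q(1)] by (auto simp: Q_def)
  then have "cbox a b \<subseteq> fcone Q"
    unfolding V(2) by (intro hull_minimal convex_fcone)
  then have "box a b \<subseteq> interior (fcone Q)"
    using box_subset_cbox[of a b] by (intro interior_maximal) auto
  then show thesis
    using that Q ab(2) by blast
qed

section \<open>Sections of cones and distances to their boundary\<close>

lemma slice_scaleR:
  fixes C :: "(real \<times> (real ^ 'n)) set"
  assumes "cone C" "x \<in> slice d C" "0 \<le> c"
  shows "c *\<^sub>R x \<in> slice (c * d) C"
  using assms unfolding cone_def slice_def by fastforce

text \<open>Radial projection to \<open>h = 1\<close> is continuous on \<open>h > 0\<close>, so the
  preimage of the ball is an open neighbourhood of the point; it lies in \<open>C\<close> because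
  \<open>C\<close> is a cone.\<close>

lemma interior_of_slice_ball:
  fixes C :: "(real \<times> (real ^ 'n)) set"
  assumes C: "cone C" and e: "0 < e" "ball v e \<subseteq> slice 1 C"
  shows "(1, v) \<in> interior C"
proof -
  let ?f = "\<lambda>p :: real \<times> (real ^ 'n). (1 / fst p) *\<^sub>R snd p"
  let ?U = "{p :: real \<times> (real ^ 'n). 0 < fst p}"
  have "open ?U"
    by (intro open_Collect_less continuous_intros)
  moreover have "continuous_on ?U ?f"
    by (intro continuous_intros) auto
  ultimately have "open (?U \<inter> ?f -` ball v e)"
    by (intro continuous_open_preimage) auto
  moreover have "?U \<inter> ?f -` ball v e \<subseteq> C"
  proof
    fix p assume p: "p \<in> ?U \<inter> ?f -` ball v e"
    then have "?f p \<in> slice 1 C" using e(2) by auto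
    then have "fst p *\<^sub>R ?f p \<in> slice (fst p * 1) C"
      using p by (intro slice_scaleR[OF C]) auto
    then show "p \<in> C"
      using p by (simp add: slice_def)
  qed
  moreover have "(1, v) \<in> ?U \<inter> ?f -` ball v e"
    using e(1) by simp
  ultimately show ?thesis
    by (meson interiorI)
qed

lemma slice_ball_of_interior:
  fixes C :: "(real \<times> (real ^ 'n)) set"
  assumes "(1, v) \<in> interior C"
  obtains e where "0 < e" "ball v e \<subseteq> slice 1 C"
proof -
  have "open ((\<lambda>x. (1, x)) -` interior C)"
    by (intro open_vimage open_interior continuous_intros)
  then obtain e where "0 < e" "ball v e \<subseteq> (\<lambda>x. (1, x)) -` interior C"
    using assms open_contains_ball by (metis vimageI)
  then show thesis
    using that[of e] interior_subset[of C] by (auto simp: slice_def)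
qed

text \<open>On the compact set of unit vectors of \<open>C\<close> the degree is positive, hence
  bounded below by some \<mu> > 0; by homogeneity 1 / \<mu> is a suitable constant.\<close>

lemma positive_cone_bound:
  fixes C :: "(real \<times> (real ^ 'n)) set"
  assumes C: "positive_cone C"
  obtains R where "0 < R" "\<And>p. p \<in> C \<Longrightarrow> norm (snd p) \<le> R * fst p"
proof -
  let ?S = "C \<inter> sphere 0 1"
  have C': "closed C" "cone C" "\<And>p. p \<in> C \<Longrightarrow> 0 \<le> fst p" "C \<inter> {p. fst p = 0} = {0}"
    using C unfolding positive_cone_def by auto
  have pos: "0 < fst p" if "p \<in> C" "p \<noteq> 0" for p
    using C'(3)[OF that(1)] C'(4) that by fastforce
  have "compact ?S"
    using C'(1) by (simp add: closed_Int_compact)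
  then have cpt: "compact (fst ` ?S)"
    by (intro compact_continuous_image continuous_intros)
  obtain \<mu> where \<mu>: "0 < \<mu>" "\<And>p. p \<in> ?S \<Longrightarrow> \<mu> \<le> fst p"
  proof (cases "?S = {}")
    case True
    then show thesis using that[of 1] by auto
  next
    case False
    then have "fst ` ?S \<noteq> {}" by blast
    from compact_attains_inf[OF cpt this] obtain p where "p \<in> ?S" "\<forall>t\<in>fst ` ?S. fst p \<le> t"
      by blast
    moreover from this have "p \<in> C" "p \<noteq> 0" by auto
    then have "0 < fst p" by (rule pos)
    ultimately show thesis
      by (intro that[of "fst p"]) blast+
  qed
  have "norm (snd p) \<le> (1 / \<mu>) * fst p" if p: "p \<in> C" for p
  proof (cases "p = 0")
    case False
    then have "(1 / norm p) *\<^sub>R p \<in> ?S"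
      using p C'(2) unfolding cone_def by auto
    then have "\<mu> \<le> fst ((1 / norm p) *\<^sub>R p)"
      by (rule \<mu>(2))
    then have "\<mu> * norm p \<le> fst p"
      using False by (simp add: field_simps)
    moreover have "norm (snd p) \<le> norm p"
      using norm_snd_le[of "snd p" "fst p"] by simp
    then have "\<mu> * norm (snd p) \<le> \<mu> * norm p"
      using \<mu>(1) by simp
    ultimately have "\<mu> * norm (snd p) \<le> fst p"
      by linarith
    then show ?thesis
      using \<mu>(1) by (simp add: field_simps)
  qed simp
  then show thesis
    using that[of "1 / \<mu>"] \<mu>(1) by simp
qed

lemma compact_slice_positive_cone:
  fixes C :: "(real \<times> (real ^ 'n)) set"
  assumes "positive_cone C"
  shows "compact (slice d C)"
proof -
  obtain R where R: "\<And>p. p \<in> C \<Longrightarrow> norm (snd p) \<le> R * fst p"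
    using positive_cone_bound[OF assms] by blast
  have "bounded (slice d C)"
    unfolding bounded_iff slice_def using R by (intro exI[of _ "R * d"]) force
  moreover have "closed ((\<lambda>x. (d, x)) -` C)"
    using assms unfolding positive_cone_def by (intro closed_vimage continuous_intros) auto
  then have "closed (slice d C)"
    by (simp add: slice_def vimage_def)
  ultimately show ?thesis
    by (simp add: compact_eq_bounded_closed)
qed

text \<open>A compact section holds finitely many lattice points; this makes the \<open>Max\<close>
  in \<open>defect\<close> a maximum over a finite set.\<close>

lemma finite_slice_positive_cone:
  fixes C :: "(real \<times> (real ^ 'n)) set"
  assumes "positive_cone C" "\<And>p. p \<in> M \<Longrightarrow> real_point p \<in> C"
  shows "finite (slice d M)"
proof -
  obtain B where B: "\<And>x. x \<in> slice (real_of_int d) C \<Longrightarrow> norm x \<le> B"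
    using compact_imp_bounded[OF compact_slice_positive_cone[OF assms(1), of "real_of_int d"]]
    unfolding bounded_iff by blast
  have "slice d M \<subseteq> {x. norm (real_vec x) \<le> B}"
    using B assms(2) by (fastforce simp: slice_def real_point_def)
  then show ?thesis
    by (rule finite_subset) (rule finite_real_vec_bounded)
qed

text \<open>Balls are connected, so one that meets both \<open>S\<close> and its complement contains
  a frontier point, at distance less than \<open>r\<close>.\<close>

lemma ball_subset_of_infdist_frontier:
  fixes S :: "'a::real_normed_vector set"
  assumes "x \<in> S" "r \<le> infdist x (frontier S)"
  shows "ball x r \<subseteq> S"
proof (rule ccontr)
  assume "\<not> ball x r \<subseteq> S"
  then obtain y where "y \<in> ball x r" "y \<notin> S" by blast
  then have "dist x y < r" by simp
  then have "0 < r" using zero_le_dist[of x y] by linarith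
  with assms(1) have "x \<in> ball x r \<inter> S" by simp
  then have "ball x r \<inter> frontier S \<noteq> {}"
    using \<open>y \<in> ball x r\<close> \<open>y \<notin> S\<close> connected_ball[of x r]
    by (intro connected_Int_frontier) blast+
  then obtain z where "z \<in> frontier S" "dist x z < r" by auto
  then show False
    using infdist_le[of z "frontier S" x] assms(2) by linarith
qed

text \<open>The open ball lies in the interior and so avoids the frontier. The condition
  \<open>S \<noteq> UNIV\<close> excludes an empty frontier, for which \<open>infdist\<close>
  defaults to 0.\<close>

lemma infdist_frontier_ge:
  fixes S :: "'a::real_normed_vector set"
  assumes "ball x r \<subseteq> S" "S \<noteq> UNIV"
  shows "r \<le> infdist x (frontier S)"
proof (cases "0 < r")
  case True
  then have "frontier S \<noteq> {}"
    using assms frontier_eq_empty[of S] by auto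
  moreover have "r \<le> dist x y" if "y \<in> frontier S" for y
  proof (rule ccontr)
    assume "\<not> r \<le> dist x y"
    then have "y \<in> interior S"
      using interior_maximal[OF assms(1) open_ball] by auto
    then show False using that by (simp add: frontier_def)
  qed
  ultimately show ?thesis
    unfolding infdist_notempty[OF \<open>frontier S \<noteq> {}\<close>] by (intro cINF_greatest) auto
qed (use infdist_nonneg[of x "frontier S"] in linarith)

section \<open>Existence of the approximating semigroup\<close>

text \<open>The linear bound describes a closed convex cone that meets \<open>h = 0\<close> only in
  0, so it passes from \<open>G\<close> to the closure of its cone. Full dimension comes from
  complete rank, since affine and linear dimension agree for a set containing 0.\<close>

lemma closure_gcone_positive:
  fixes G :: "(int \<times> (int ^ 'n)) set"
  assumes G: "graded_semigroup G" "complete_rank G" "limited_growth G"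
  shows "positive_cone (closure (gcone G))"
proof -
  let ?C = "closure (gcone G)"
  obtain R where R: "0 \<le> R" "\<And>p. p \<in> G \<Longrightarrow> norm (real_vec (snd p)) \<le> R * real_of_int (fst p)"
    using limited_growth_bounded[OF G] by metis
  have nonneg: "0 \<le> fst p" if "p \<in> G" for p
    using G(1) that unfolding graded_semigroup_def by blast
  let ?B = "{p :: real \<times> (real ^ 'n). 0 \<le> fst p \<and> norm (snd p) \<le> R * fst p}"
  have "gcone G \<subseteq> ?B"
  proof (rule gcone_minimal)
    show "real_point ` G \<subseteq> ?B"
      using R(2) nonneg by auto
    have norm_le: "norm (u *\<^sub>R x + v *\<^sub>R y) \<le> R * (u * a + v * b)"
      if "0 \<le> u" "0 \<le> v" "norm x \<le> R * a" "norm y \<le> R * b" for u v a b :: real and x y :: "real ^ 'n"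
    proof -
      have "norm (u *\<^sub>R x + v *\<^sub>R y) \<le> u * norm x + v * norm y"
        using norm_triangle_ineq[of "u *\<^sub>R x" "v *\<^sub>R y"] that(1,2) by simp
      also have "\<dots> \<le> u * (R * a) + v * (R * b)"
        using that by (intro add_mono mult_left_mono)
      finally show ?thesis by (simp add: algebra_simps)
    qed
    show "convex ?B"
      by (rule convexI) (auto simp: norm_le)
    show "cone ?B"
      by (auto simp: cone_def) (metis mult.left_commute mult_left_mono)
  qed simp
  moreover have "closed ?B"
    by (intro closed_Collect_conj closed_Collect_le continuous_intros)
  ultimately have B: "?C \<subseteq> ?B"
    by (rule closure_minimal)
  have 0: "0 \<in> ?C"
    using zero_in_gcone closure_subset by blast
  have "real_point ` G \<subseteq> ?C"
    using real_point_in_gcone closure_subset by blast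
  then have "span ?C = UNIV"
    using complete_rank_span[OF G(2)] span_mono[of "real_point ` G" ?C] by auto
  then have "aff_dim ?C = int (CARD('n) + 1)"
    using aff_dim_zero[of ?C] hull_inc[OF 0, of affine] dim_eq_full[of ?C] by simp
  moreover have "?C \<inter> {p. fst p = 0} = {0}"
  proof
    show "?C \<inter> {p. fst p = 0} \<subseteq> {0}"
    proof
      fix p assume p: "p \<in> ?C \<inter> {p. fst p = 0}"
      then have "p \<in> ?B" "fst p = 0" using B by blast+
      then show "p \<in> {0}" by (simp add: prod_eq_iff)
    qed
  qed (use 0 in simp)
  ultimately show ?thesis
    unfolding positive_cone_def
    using B convex_closure[OF convex_gcone] cone_closure[OF cone_gcone] by auto
qed

text \<open>A sequence of missing points far from the boundary, rescaled to degree \<open>1\<close>, accumulates at an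
  interior point of \<open>C(1)\<close>; near it the cone is spanned by finitely many elements of \<open>G\<close>.\<close>

lemma missing_points_near_frontier:
  fixes G :: "(int \<times> (int ^ 'n)) set" and e :: real
  defines "C \<equiv> closure (gcone G)"
  assumes G: "graded_semigroup G" and C: "positive_cone C" and e: "0 < e"
  shows "\<exists>N. \<forall>d\<ge>N. \<forall>x. (int d, x) \<in> group_closure G - G \<longrightarrow> real_point (int d, x) \<in> C \<longrightarrow>
    infdist (real_vec x) (frontier (slice (real d) C)) < e * real d"
proof (rule ccontr)
  assume "\<not> ?thesis"
  \<comment> \<open>Asking for degree at least \<open>Suc N\<close> keeps all degrees positive, so
    rescaling to degree 1 is possible, and makes them tend to infinity.\<close>
  then have "\<forall>N. \<exists>dx. Suc N \<le> fst dx \<and> (int (fst dx), snd dx) \<in> group_closure G - G \<and>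
      real_point (int (fst dx), snd dx) \<in> C \<and>
      e * real (fst dx) \<le> infdist (real_vec (snd dx)) (frontier (slice (real (fst dx)) C))"
    by (simp add: not_less)
  from choice[OF this] obtain f where f: "\<And>N. Suc N \<le> fst (f N)"
      "\<And>N. (int (fst (f N)), snd (f N)) \<in> group_closure G - G"
      "\<And>N. real_point (int (fst (f N)), snd (f N)) \<in> C"
      "\<And>N. e * real (fst (f N)) \<le> infdist (real_vec (snd (f N))) (frontier (slice (real (fst (f N))) C))"
    by blast
  define d where "d N = real (fst (f N))" for N
  define y where "y N = (1 / d N) *\<^sub>R real_vec (snd (f N))" for N
  have d: "real (Suc N) \<le> d N" for N
    using f(1)[of N] unfolding d_def by (rule of_nat_mono)
  then have dpos: "0 < d N" for N
    using of_nat_0_less_iff[of "Suc N"] by (metis less_le_trans zero_less_Suc)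
  have cone: "cone C"
    using C by (simp add: positive_cone_def)
  have point: "real_point (int (fst (f N)), snd (f N)) = (d N, d N *\<^sub>R y N)" for N
    using dpos[of N] by (simp add: real_point_def d_def y_def)
  have ball: "ball (y N) e \<subseteq> slice 1 C" for N
  proof
    fix w assume "w \<in> ball (y N) e"
    then have "d N * dist (y N) w < d N * e"
      using dpos[of N] by simp
    moreover have "dist (d N *\<^sub>R y N) (d N *\<^sub>R w) = d N * dist (y N) w"
      using dpos[of N] by (simp add: dist_norm flip: scaleR_right_diff_distrib)
    ultimately have "dist (d N *\<^sub>R y N) (d N *\<^sub>R w) < e * d N"
      by (simp add: mult.commute)
    moreover have "ball (d N *\<^sub>R y N) (e * d N) \<subseteq> slice (d N) C"
    proof (rule ball_subset_of_infdist_frontier)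
      show "d N *\<^sub>R y N \<in> slice (d N) C"
        using f(3)[of N] unfolding point by (simp add: slice_def)
      show "e * d N \<le> infdist (d N *\<^sub>R y N) (frontier (slice (d N) C))"
        using f(4)[of N] dpos[of N] by (simp add: d_def y_def)
    qed
    ultimately have "d N *\<^sub>R w \<in> slice (d N) C" by auto
    then have "(1 / d N) *\<^sub>R (d N *\<^sub>R w) \<in> slice (1 / d N * d N) C"
      using dpos[of N] by (intro slice_scaleR[OF cone]) auto
    then show "w \<in> slice 1 C"
      using dpos[of N] by simp
  qed
  then have "y N \<in> slice 1 C" for N
    using e by (meson centre_in_ball subsetD)
  then obtain v r where r: "strict_mono r" "(y \<circ> r) \<longlonglongrightarrow> v"
    using compact_slice_positive_cone[OF C, of 1] unfolding compact_def by metis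
  have "\<forall>\<^sub>F N in sequentially. dist ((y \<circ> r) N) v < e / 2"
    using e by (intro tendstoD[OF r(2)]) simp
  then obtain N where N: "dist (y (r N)) v < e / 2"
    by (auto simp: eventually_sequentially)
  \<comment> \<open>All rescaled points have balls of the same radius \<open>e\<close> inside the
    section, so their limit \<open>v\<close> keeps one of radius \<open>e / 2\<close>.\<close>
  have "ball v (e / 2) \<subseteq> ball (y (r N)) e"
    using N dist_triangle_less_add[of "y (r N)" v "e / 2" _ "e / 2"] by (auto simp: dist_commute)
  then have "ball v (e / 2) \<subseteq> slice 1 C"
    using ball[of "r N"] by blast
  then have "(1, v) \<in> interior C"
    using e by (intro interior_of_slice_ball[OF cone]) auto
  then have "(1, v) \<in> interior (gcone G)"
    by (simp add: C_def convex_interior_closure convex_gcone)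
  then obtain P where P: "finite P" "P \<subseteq> G" "(1, v) \<in> interior (fcone P)"
    by (rule interior_gcone_finite)
  have ne: "G \<noteq> {}"
    using graded_semigroup_degree_1[OF G] by auto
  obtain z where z: "z \<in> G" "\<And>x. x \<in> group_closure G \<Longrightarrow> real_point x - real_point z \<in> fcone P \<Longrightarrow> x \<in> G"
    using conductor_exists[OF graded_semigroup_add[OF G] ne P(1,2)] by metis
  have "filterlim d at_top sequentially"
  proof (rule filterlim_at_top_mono)
    show "filterlim (\<lambda>N. real (Suc N)) at_top sequentially"
      by (rule filterlim_compose[OF filterlim_real_sequentially filterlim_Suc])
  qed (use d in auto)
  then have "filterlim (\<lambda>N. d (r N)) at_top sequentially"
    using filterlim_compose filterlim_subseq[OF r(1)] by blast
  then have "((\<lambda>N. 1 / d (r N)) \<longlongrightarrow> 0) sequentially"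
    by (intro tendsto_divide_0[OF tendsto_const] filterlim_at_top_imp_at_infinity)
  \<comment> \<open>At degree 1 the translation by \<open>z\<close> shrinks to 0, so the translated
    points enter the open set \<open>interior (fcone P)\<close>. Scaling back, a supposedly missing
    point satisfies the conductor condition and lies in \<open>G\<close>.\<close>
  then have "((\<lambda>N. (1, y (r N)) - (1 / d (r N)) *\<^sub>R real_point z) \<longlongrightarrow> (1, v) - 0 *\<^sub>R real_point z) sequentially"
    using r(2) by (intro tendsto_intros) (auto simp: o_def)
  then have "\<forall>\<^sub>F N in sequentially. (1, y (r N)) - (1 / d (r N)) *\<^sub>R real_point z \<in> interior (fcone P)"
    using P(3) by (intro topological_tendstoD) auto
  then obtain N where "(1, y (r N)) - (1 / d (r N)) *\<^sub>R real_point z \<in> interior (fcone P)"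
    by (auto simp: eventually_sequentially)
  then have "(1, y (r N)) - (1 / d (r N)) *\<^sub>R real_point z \<in> fcone P"
    using interior_subset by blast
  then have "d (r N) *\<^sub>R ((1, y (r N)) - (1 / d (r N)) *\<^sub>R real_point z) \<in> fcone P"
    using dpos[of "r N"] by (intro fcone_scaleR) auto
  also have "d (r N) *\<^sub>R ((1, y (r N)) - (1 / d (r N)) *\<^sub>R real_point z)
      = real_point (int (fst (f (r N))), snd (f (r N))) - real_point z"
    unfolding point using dpos[of "r N"] by (simp add: scaleR_right_diff_distrib)
  finally show False
    using z(2) f(2)[of "r N"] by blast
qed

lemma closure_gcone_approximates:
  fixes G :: "(int \<times> (int ^ 'n)) set"
  assumes G: "graded_semigroup G" and C: "positive_cone (closure (gcone G))"
  shows "approximates (closure (gcone G)) {p \<in> group_closure G. real_point p \<in> closure (gcone G)} G"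
    (is "approximates ?C ?M G")
  unfolding approximates_def
proof
  show "G \<subseteq> ?M"
    using subset_group_closure[of G] real_point_in_gcone closure_subset by blast
  show "(\<lambda>d. defect ?C ?M G d / real d) \<longlonglongrightarrow> 0"
  proof (rule LIMSEQ_I)
    fix e :: real assume e: "0 < e"
    obtain N where N: "\<And>d x. N \<le> d \<Longrightarrow> (int d, x) \<in> group_closure G - G \<Longrightarrow> real_point (int d, x) \<in> ?C \<Longrightarrow>
        infdist (real_vec x) (frontier (slice (real d) ?C)) < e * real d"
      using missing_points_near_frontier[OF G C e] by blast
    \<comment> \<open>With \<open>Suc N\<close> the degree is positive, as needed for the division
      and for the strict bound when no point is missing.\<close>
    have "norm (defect ?C ?M G d / real d - 0) < e" if d: "Suc N \<le> d" for d
    proof -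
      let ?D = "slice (int d) ?M - slice (int d) G"
      let ?r = "\<lambda>x. infdist (real_vec x) (frontier (slice (real d) ?C))"
      have "finite ?D"
        using finite_slice_positive_cone[OF C, of ?M "int d"] by auto
      have less: "?r x < e * real d" if "x \<in> ?D" for x
        using that d by (intro N) (auto simp: slice_def)
      have "0 \<le> defect ?C ?M G d \<and> defect ?C ?M G d < e * real d"
      proof (cases "?D = {}")
        case True
        then show ?thesis using e d by (simp add: defect_def)
      next
        case False
        then have eq: "defect ?C ?M G d = Max (?r ` ?D)"
          by (simp add: defect_def Let_def)
        obtain x where x: "x \<in> ?D" using False by blast
        have "0 \<le> ?r x" by (rule infdist_nonneg)
        also have "?r x \<le> Max (?r ` ?D)"
          using \<open>finite ?D\<close> x by (intro Max_ge) auto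
        finally show ?thesis
          unfolding eq using \<open>finite ?D\<close> False less by (subst Max_less_iff) auto
      qed
      then show ?thesis using d by (simp add: field_simps)
    qed
    then show "\<exists>N. \<forall>d\<ge>N. norm (defect ?C ?M G d / real d - 0) < e" by blast
  qed
qed

text \<open>Choose \<open>A\<close> as an element \<open>a\<close> of \<open>G\<close> of degree 1
  and \<open>T\<close> as the degree-0 part of the generated group: subtracting \<open>fst p\<close>
  times \<open>a\<close> from a group element \<open>p\<close> leaves an element of
  \<open>T\<close>.\<close>

lemma closure_gcone_type:
  fixes G :: "(int \<times> (int ^ 'n)) set"
  assumes G: "graded_semigroup G" "complete_rank G" and C: "positive_cone C"
  shows "\<exists>T A. semigroup_of_type C T A {p \<in> group_closure G. real_point p \<in> C}"
proof -
  let ?L = "group_closure G"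
  note L = add_subgroup_group_closure[of G]
  obtain a where a: "a \<in> G" "fst a = 1"
    using graded_semigroup_degree_1[OF G(1)] .
  then have aL: "a \<in> ?L" using subset_group_closure by blast
  define T where "T = {t. (0, t) \<in> ?L}"
  have T: "add_subgroup T"
    unfolding add_subgroup_def
  proof (intro conjI ballI)
    show "0 \<in> T"
      using L by (simp add: add_subgroup_def T_def zero_prod_def)
    show "x + y \<in> T" if "x \<in> T" "y \<in> T" for x y
      using group_closure_add[of "(0, x)" G "(0, y)"] that by (simp add: T_def)
    show "- x \<in> T" if "x \<in> T" for x
      using group_closure_minus_iff[of "(0, x)" G] that by (simp add: T_def)
  qed
  \<comment> \<open>Every coset of \<open>T\<close> is the degree-0 section of a coset of the
    generated group, so finiteness of the number of cosets is inherited.\<close>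
  have "range (\<lambda>x. (+) x ` T) \<subseteq> (\<lambda>S. {t. (0, t) \<in> S}) ` range (\<lambda>x. (+) x ` ?L)"
  proof clarify
    fix x
    have "(+) x ` T = {t. (0, t) \<in> (+) (0, x) ` ?L}"
    proof (intro equalityI subsetI CollectI)
      fix t assume "t \<in> (+) x ` T"
      then obtain s where "(0, s) \<in> ?L" "t = x + s" by (auto simp: T_def)
      then show "(0, t) \<in> (+) (0, x) ` ?L"
        by (intro image_eqI[of _ _ "(0, s)"]) auto
    next
      fix t assume "t \<in> {t. (0, t) \<in> (+) (0, x) ` ?L}"
      then obtain p where p: "p \<in> ?L" "(0, t) = (0, x) + p" by blast
      obtain h s where "p = (h, s)" by fastforce
      with p show "t \<in> (+) x ` T"
        by (intro image_eqI[of _ _ s]) (simp_all add: T_def)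
    qed
    then show "(+) x ` T \<in> (\<lambda>S. {t. (0, t) \<in> S}) ` range (\<lambda>x. (+) x ` ?L)"
      by blast
  qed
  then have "finite_index T"
    using G(2) finite_subset unfolding complete_rank_def finite_index_def by blast
  moreover have "p \<in> ?L \<longleftrightarrow> (\<exists>l. \<exists>t\<in>T. p = (l * fst a, l *s snd a + t))" for p
  proof
    assume p: "p \<in> ?L"
    have "p - zscale (fst p) a \<in> ?L"
      using L p aL by (intro add_subgroup_diff zscale_mem_subgroup)
    moreover have "p - zscale (fst p) a = (0, snd p - fst p *s snd a)"
      using a(2) by (simp add: zscale_def prod_eq_iff)
    ultimately show "\<exists>l. \<exists>t\<in>T. p = (l * fst a, l *s snd a + t)"
      using a(2) by (intro exI[of _ "fst p"] bexI[of _ "snd p - fst p *s snd a"]) (auto simp: T_def)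
  next
    assume "\<exists>l. \<exists>t\<in>T. p = (l * fst a, l *s snd a + t)"
    then obtain l t where "(0, t) \<in> ?L" "p = zscale l a + (0, t)"
      by (auto simp: T_def zscale_def)
    then show "p \<in> ?L"
      using zscale_mem_subgroup[OF L aL, of l] L unfolding add_subgroup_def by blast
  qed
  ultimately have "semigroup_of_type C T a {p \<in> ?L. real_point p \<in> C}"
    unfolding semigroup_of_type_def using C T a(2) by auto
  then show ?thesis by blast
qed

section \<open>Uniqueness of the approximating semigroup\<close>

text \<open>Round \<open>w\<close> to a lattice point of degree \<open>d\<close> and move it into
  the coset of \<open>p\<close> by subtracting one of finitely many representatives
  \<open>f\<close>. Adding \<open>fst f\<close> times \<open>a\<close> restores the degree without
  leaving the coset, and finiteness makes \<open>R\<close> independent of \<open>d\<close> and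
  \<open>w\<close>.\<close>

lemma lattice_coset_dense:
  fixes L :: "(int \<times> (int ^ 'n)) set"
  assumes L: "add_subgroup L" "finite_index L" and a: "a \<in> L" "fst a = 1"
  obtains R where "0 \<le> R" "\<And>d w. \<exists>y. (d, y) - p \<in> L \<and> norm (real_vec y - w) \<le> R"
proof -
  let ?f = "\<lambda>x. (+) x ` L"
  have "finite (range ?f)"
    using L(2) by (simp add: finite_index_def)
  then have "\<exists>F\<subseteq>UNIV. finite F \<and> range ?f = ?f ` F"
    by (rule finite_subset_image) (rule subset_refl)
  then obtain F where F: "finite F" "range ?f = ?f ` F"
    by (elim exE conjE)
  have rep: "\<exists>f\<in>F. x - f \<in> L" for x
  proof -
    have "?f x \<in> ?f ` F"
      unfolding F(2)[symmetric] by (rule rangeI)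
    then obtain f where f: "?f x = ?f f" "f \<in> F" by (rule imageE)
    have "x \<in> ?f x"
      using L(1) unfolding add_subgroup_def by (intro image_eqI[of _ _ 0]) auto
    then obtain l where "x = f + l" "l \<in> L" unfolding f(1) by (rule imageE)
    then show ?thesis using f(2) by (intro bexI[of _ f]) simp_all
  qed
  let ?g = "\<lambda>f. real_vec (snd (zscale (fst f) a - f))"
  define R where "R = real CARD('n) + (\<Sum>f\<in>F. norm (?g f))"
  have "\<exists>y. (d, y) - p \<in> L \<and> norm (real_vec y - w) \<le> R" for d w
  proof -
    define y0 :: "int ^ 'n" where "y0 = (\<chi> i. \<lfloor>w $ i\<rfloor>)"
    have "norm (real_vec y0 - w) \<le> (\<Sum>i\<in>UNIV. \<bar>(real_vec y0 - w) $ i\<bar>)"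
      by (rule norm_le_l1_cart)
    also have "\<dots> \<le> (\<Sum>i\<in>(UNIV :: 'n set). 1)"
      by (intro sum_mono) (simp add: real_vec_def y0_def, linarith)
    finally have y0: "norm (real_vec y0 - w) \<le> real CARD('n)" by simp
    obtain f where f: "f \<in> F" "(d, y0) - p - f \<in> L"
      using rep by blast
    define y where "y = y0 + snd (zscale (fst f) a - f)"
    have "(d, y) - p = ((d, y0) - p - f) + zscale (fst f) a"
      using a(2) by (simp add: y_def prod_eq_iff)
    also have "\<dots> \<in> L"
      using f(2) zscale_mem_subgroup[OF L(1) a(1), of "fst f"] L(1) unfolding add_subgroup_def by blast
    finally have mem: "(d, y) - p \<in> L" .
    have "real_vec y - w = (real_vec y0 - w) + ?g f"
      by (simp add: y_def real_vec_def vec_eq_iff)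
    then have "norm (real_vec y - w) \<le> norm (real_vec y0 - w) + norm (?g f)"
      by (simp only: norm_triangle_ineq)
    also have "\<dots> \<le> R"
      unfolding R_def using y0 member_le_sum[OF f(1), of "\<lambda>f. norm (?g f)"] F(1)
      by (intro add_mono) auto
    finally show ?thesis using mem by blast
  qed
  moreover have "0 \<le> R" unfolding R_def by (intro add_nonneg_nonneg sum_nonneg) auto
  ultimately show thesis using that by blast
qed

text \<open>The distance from \<open>d v\<close> to the boundary of the section grows at least
  linearly in \<open>d\<close>, while \<open>R\<close> is constant and the defect is sublinear. For
  large \<open>d\<close>, points of \<open>L\<close> within \<open>R\<close> of \<open>d v\<close>
  thus lie in \<open>M\<close>, too deep inside the section to be missing from
  \<open>G\<close>.\<close>

lemma approximates_eventually_mem: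
  fixes G :: "(int \<times> (int ^ 'n)) set"
  assumes C: "positive_cone C" and v: "(1, v) \<in> interior C"
    and M: "M = {p \<in> L. real_point p \<in> C}" and appr: "approximates C M G"
  shows "\<forall>\<^sub>F d in sequentially.
    \<forall>y. (int d, y) \<in> L \<longrightarrow> norm (real_vec y - real d *\<^sub>R v) \<le> R \<longrightarrow> (int d, y) \<in> G"
proof -
  obtain e where e: "0 < e" "ball v e \<subseteq> slice 1 C"
    using slice_ball_of_interior[OF v] .
  have cone: "cone C"
    using C by (simp add: positive_cone_def)
  \<comment> \<open>The margin \<open>e * d\<close> is split evenly: \<open>R\<close> uses up less
    than half of it, and the defect stays below the other half.\<close>
  have "\<forall>\<^sub>F d in sequentially. dist (defect C M G d / real d) 0 < e / 2"
    using appr e(1) unfolding approximates_def by (intro tendstoD) auto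
  moreover have "\<forall>\<^sub>F d in sequentially. 2 * \<bar>R\<bar> / e < real d"
    using filterlim_real_sequentially by (simp add: filterlim_at_top_dense)
  moreover have "\<forall>\<^sub>F d::nat in sequentially. 0 < d"
    by (rule eventually_gt_at_top)
  ultimately show ?thesis
  proof eventually_elim
    case (elim d)
    have R: "2 * R < e * real d"
      using elim(2) e(1) by (simp add: field_simps)
    show ?case
    proof (intro allI impI, rule ccontr)
      fix y assume y: "(int d, y) \<in> L" "norm (real_vec y - real d *\<^sub>R v) \<le> R" "(int d, y) \<notin> G"
      let ?S = "slice (real d) C"
      have ball: "ball (real_vec y) (e * real d - R) \<subseteq> ?S"
      proof
        fix w assume "w \<in> ball (real_vec y) (e * real d - R)"
        then have "dist (real d *\<^sub>R v) w < e * real d"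
          using y(2) dist_triangle[of "real d *\<^sub>R v" w "real_vec y"]
          by (simp add: dist_norm norm_minus_commute)
        moreover have "dist (real d *\<^sub>R v) w = real d * dist v ((1 / real d) *\<^sub>R w)"
        proof -
          have "real d *\<^sub>R v - w = real d *\<^sub>R (v - (1 / real d) *\<^sub>R w)"
            using elim(3) by (simp add: scaleR_right_diff_distrib)
          then show ?thesis by (simp add: dist_norm)
        qed
        ultimately have "(1 / real d) *\<^sub>R w \<in> ball v e"
          using elim(3) by (simp add: mult.commute)
        then have "real d *\<^sub>R ((1 / real d) *\<^sub>R w) \<in> slice (real d * 1) C"
          using e(2) by (intro slice_scaleR[OF cone]) auto
        then show "w \<in> ?S" using elim(3) by simp
      qed
      have "0 < e * real d - R"
        using R e(1) elim(3) by (smt (verit) mult_pos_pos of_nat_0_less_iff)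
      then have "real_vec y \<in> ?S" using ball by (meson centre_in_ball subsetD)
      then have yM: "(int d, y) \<in> M"
        using y(1) by (simp add: M slice_def real_point_def)
      have "?S \<noteq> UNIV"
        using compact_imp_bounded[OF compact_slice_positive_cone[OF C]] not_bounded_UNIV by metis
      then have "e * real d - R \<le> infdist (real_vec y) (frontier ?S)"
        using ball by (rule infdist_frontier_ge[rotated])
      also have "\<dots> \<le> defect C M G d"
      proof -
        let ?D = "slice (int d) M - slice (int d) G"
        have "y \<in> ?D" using yM y(3) by (simp add: slice_def)
        moreover have "finite ?D"
          using finite_slice_positive_cone[OF C, of M] by (simp add: M)
        ultimately have "infdist (real_vec y) (frontier ?S) \<le> Max ((\<lambda>x. infdist (real_vec x) (frontier ?S)) ` ?D)"
          by (intro Max_ge) auto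
        with \<open>y \<in> ?D\<close> show ?thesis
          unfolding defect_def Let_def by (subst if_not_P) auto
      qed
      also have "\<dots> < e / 2 * real d"
        using elim(1,3) by (simp add: dist_norm abs_less_iff field_simps)
      finally show False using R by simp
    qed
  qed
qed

lemma interior_cone_normalize:
  fixes C :: "(real \<times> (real ^ 'n)) set"
  assumes C: "cone C" and p: "p \<in> interior C" "0 < fst p"
  shows "(1, (1 / fst p) *\<^sub>R snd p) \<in> interior C"
proof -
  let ?U = "(\<lambda>x. fst p *\<^sub>R x) -` interior C"
  have "open ?U"
    by (intro open_vimage open_interior continuous_intros)
  moreover have "?U \<subseteq> C"
  proof
    fix x assume "x \<in> ?U"
    then have "fst p *\<^sub>R x \<in> C" using interior_subset by auto
    then have "(1 / fst p) *\<^sub>R (fst p *\<^sub>R x) \<in> C"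
      using C p(2) unfolding cone_def by (meson divide_nonneg_pos zero_le_one)
    then show "x \<in> C" using p(2) by simp
  qed
  moreover have "fst p *\<^sub>R (1, (1 / fst p) *\<^sub>R snd p) = p"
    using p(2) by (simp add: prod_eq_iff)
  ultimately show ?thesis
    using p(1) by (intro interiorI[of ?U]) simp_all
qed

text \<open>From an interior point one can still lower the degree a little without leaving the
  half-space \<open>h \<ge> 0\<close>.\<close>

lemma positive_cone_interior_pos:
  fixes C :: "(real \<times> (real ^ 'n)) set"
  assumes C: "positive_cone C" and p: "p \<in> interior C"
  shows "0 < fst p"
proof -
  obtain e where e: "0 < e" "ball p e \<subseteq> C"
    using p by (auto simp: mem_interior)
  have "p - (e / 2, 0) \<in> ball p e"
    using e(1) by (simp add: dist_norm)
  then have "p - (e / 2, 0) \<in> C" using e(2) by blast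
  then have "0 \<le> fst (p - (e / 2, 0))"
    using C unfolding positive_cone_def by blast
  then show ?thesis using e(1) by simp
qed

lemma positive_cone_interior_degree_1:
  fixes C :: "(real \<times> (real ^ 'n)) set"
  assumes C: "positive_cone C"
  obtains v where "(1, v) \<in> interior C"
proof -
  have C': "convex C" "cone C" "aff_dim C = int (CARD('n) + 1)"
    using C unfolding positive_cone_def by auto
  have "C \<noteq> {}" using C'(3) aff_dim_empty[of C] by auto
  then have "interior C \<noteq> {}"
    using C'(1,3) interior_rel_interior[of C] rel_interior_eq_empty[of C] by simp
  then obtain p where "p \<in> interior C" by blast
  then show thesis
    using that[OF interior_cone_normalize[OF C'(2) _ positive_cone_interior_pos[OF C]]] by blast
qed

text \<open>Lattice points close to the ray through an interior point of \<open>C\<close> lie in \<open>G\<close> in high degrees. Hence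
  every coset of \<open>group_closure G\<close> in the lattice of \<open>M\<close> meets \<open>G\<close>, and that ray lies in the closure of
  the cone over \<open>G\<close>.\<close>

lemma approximating_semigroup_unique:
  fixes G :: "(int \<times> (int ^ 'n)) set"
  assumes G: "graded_semigroup G" "complete_rank G"
    and type: "semigroup_of_type C T A M" and appr: "approximates C M G"
  shows "M = {p \<in> group_closure G. real_point p \<in> closure (gcone G)}"
proof -
  define L where "L = {p. \<exists>l. \<exists>t\<in>T. p = (l * fst A, l *s snd A + t)}"
  have C: "positive_cone C" and T: "add_subgroup T"
    and M: "M = {p \<in> L. real_point p \<in> C}"
    using type unfolding semigroup_of_type_def L_def by auto
  have C': "closed C" "convex C" "cone C" "C \<inter> {p. fst p = 0} = {0}"
    using C unfolding positive_cone_def by auto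
  have L_iff: "p \<in> L \<longleftrightarrow> (\<exists>l t. t \<in> T \<and> p = zscale l A + (0, t))" for p
    by (auto simp: L_def zscale_def)
  have L: "add_subgroup L"
    unfolding add_subgroup_def
  proof (intro conjI ballI)
    show "0 \<in> L"
      unfolding L_iff using T
      by (intro exI[of _ 0]) (simp add: add_subgroup_def zero_prod_def)
    show "x + y \<in> L" if xy: "x \<in> L" "y \<in> L" for x y
    proof -
      obtain k l s t where "s \<in> T" "t \<in> T" "x = zscale k A + (0, s)" "y = zscale l A + (0, t)"
        using xy unfolding L_iff by blast
      moreover from this have "s + t \<in> T" "x + y = zscale (k + l) A + (0, s + t)"
        using T by (auto simp: add_subgroup_def zscale_add_left prod_eq_iff)
      ultimately show ?thesis unfolding L_iff by blast
    qed
    show "- x \<in> L" if x: "x \<in> L" for x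
    proof -
      obtain k s where "s \<in> T" "x = zscale k A + (0, s)"
        using x unfolding L_iff by blast
      moreover from this have "- s \<in> T" "- x = zscale (- k) A + (0, - s)"
        using T by (auto simp: add_subgroup_def zscale_minus_left prod_eq_iff)
      ultimately show ?thesis unfolding L_iff by blast
    qed
  qed
  have GM: "G \<subseteq> M" using appr by (simp add: approximates_def)
  then have "G \<subseteq> L" "real_point ` G \<subseteq> C" by (auto simp: M)
  then have GL: "group_closure G \<subseteq> L"
    using group_closure_subset L by blast
  note H = add_subgroup_group_closure[of G]
  have fin: "finite_index (group_closure G)"
    using G(2) by (simp add: complete_rank_def)
  obtain a where a: "a \<in> group_closure G" "fst a = 1"
    using graded_semigroup_degree_1[OF G(1)] subset_group_closure[of G] by blast
  \<comment> \<open>Two facts about one point of \<open>G\<close> are recorded together: its coset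
    determines the lattice of \<open>M\<close>, its distance to the ray determines the cone.\<close>
  have near: "\<exists>R\<ge>0. \<forall>\<^sub>F d in sequentially. \<exists>y. (int d, y) - p \<in> group_closure G \<and>
      norm (real_vec y - real d *\<^sub>R v) \<le> R \<and> (int d, y) \<in> G"
    if p: "p \<in> L" and v: "(1, v) \<in> interior C" for p v
  proof -
    obtain R where R: "0 \<le> R" "\<And>d w. \<exists>y. (d, y) - p \<in> group_closure G \<and> norm (real_vec y - w) \<le> R"
      using lattice_coset_dense[OF H fin a, of p] by metis
    have mem: "(d, y) \<in> L" if "(d, y) - p \<in> group_closure G" for d y
    proof -
      have "(d, y) - p + p \<in> L"
        using that GL p L unfolding add_subgroup_def by blast
      then show ?thesis by (simp only: diff_add_cancel)
    qed
    have "\<forall>\<^sub>F d in sequentially. \<exists>y. (int d, y) - p \<in> group_closure G \<and>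
      norm (real_vec y - real d *\<^sub>R v) \<le> R \<and> (int d, y) \<in> G"
      using approximates_eventually_mem[OF C v M appr, of R]
    proof eventually_elim
      case (elim d)
      then show ?case using R(2)[of "int d" "real d *\<^sub>R v"] mem by blast
    qed
    with R(1) show ?thesis by blast
  qed
  note pos = positive_cone_interior_pos[OF C]
  obtain v0 where v0: "(1, v0) \<in> interior C"
    by (rule positive_cone_interior_degree_1[OF C])
  have "L \<subseteq> group_closure G"
  proof
    fix p assume "p \<in> L"
    from near[OF this v0] obtain R where "\<forall>\<^sub>F d in sequentially. \<exists>y. (int d, y) - p \<in> group_closure G \<and>
        norm (real_vec y - real d *\<^sub>R v0) \<le> R \<and> (int d, y) \<in> G" by blast
    from eventually_happens'[OF sequentially_bot this]
    obtain d y where "(int d, y) - p \<in> group_closure G" "(int d, y) \<in> G" by blast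
    then have "(int d, y) - ((int d, y) - p) \<in> group_closure G"
      using subset_group_closure[of G] group_closure.diff[of "(int d, y)" G "(int d, y) - p"] by blast
    then show "p \<in> group_closure G" by (cases p) simp
  qed
  with GL have "L = group_closure G" by blast
  moreover have "C = closure (gcone G)"
  proof
    have "gcone G \<subseteq> C"
      using \<open>real_point ` G \<subseteq> C\<close> C' by (intro gcone_minimal) auto
    then show "closure (gcone G) \<subseteq> C"
      using C'(1) by (rule closure_minimal)
    have ray: "(1, v) \<in> closure (gcone G)" if v: "(1, v) \<in> interior C" for v
      unfolding closure_approachable
    proof (intro allI impI)
      fix e :: real assume e: "0 < e"
      \<comment> \<open>For the cone only the distance matters, so the coset of 0 suffices: dividing
        by \<open>d\<close> turns the distance \<open>R\<close> into \<open>R / d\<close>, which is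
        below \<open>e\<close> for large \<open>d\<close>.\<close>
      have "0 \<in> L" using L by (simp add: add_subgroup_def)
      from near[OF this v] obtain R where R: "0 \<le> R"
          "\<forall>\<^sub>F d in sequentially. \<exists>y. (int d, y) - 0 \<in> group_closure G \<and>
            norm (real_vec y - real d *\<^sub>R v) \<le> R \<and> (int d, y) \<in> G"
        by blast
      have "\<forall>\<^sub>F d in sequentially. R / e < real d"
        using filterlim_real_sequentially by (simp add: filterlim_at_top_dense)
      from eventually_conj[OF R(2) this] obtain d y where
          y: "norm (real_vec y - real d *\<^sub>R v) \<le> R" "(int d, y) \<in> G" "R / e < real d"
        using eventually_happens'[OF sequentially_bot] by blast
      have d: "0 < real d"
        using y(3) R(1) e by (meson divide_nonneg_pos le_less_trans)
      have "(1 / real d) *\<^sub>R real_point (int d, y) \<in> gcone G"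
        using y(2) d by (intro gcone_scaleR real_point_in_gcone) auto
      moreover have "(1 / real d) *\<^sub>R real_point (int d, y) - (1, v)
          = (1 / real d) *\<^sub>R (0, real_vec y - real d *\<^sub>R v)"
        using d by (simp add: real_point_def scaleR_right_diff_distrib)
      then have "dist ((1 / real d) *\<^sub>R real_point (int d, y)) (1, v) = norm (real_vec y - real d *\<^sub>R v) / real d"
        by (simp add: dist_norm)
      then have "dist ((1 / real d) *\<^sub>R real_point (int d, y)) (1, v) \<le> R / real d"
        using y(1) d by (simp add: divide_right_mono)
      moreover have "R / real d < e"
        using y(3) d e by (simp add: field_simps)
      ultimately show "\<exists>z\<in>gcone G. dist z (1, v) < e" by (meson le_less_trans)
    qed
    have "interior C \<subseteq> closure (gcone G)"
    proof
      fix p assume p: "p \<in> interior C"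
      have "fst p *\<^sub>R (1, (1 / fst p) *\<^sub>R snd p) \<in> closure (gcone G)"
        using ray[OF interior_cone_normalize[OF C'(3) p pos[OF p]]] pos[OF p]
          cone_closure[OF cone_gcone, of G] unfolding cone_def by (meson less_imp_le)
      then show "p \<in> closure (gcone G)"
        using pos[OF p] by simp
    qed
    then have "closure (interior C) \<subseteq> closure (gcone G)"
      by (simp add: closure_minimal)
    moreover have "closure (interior C) = C"
      using convex_closure_interior[OF C'(2)] v0 C'(1) by auto
    ultimately show "C \<subseteq> closure (gcone G)" by simp
  qed
  ultimately show ?thesis using M by simp
qed

theorem theorem3p23:
  fixes G :: "(int \<times> (int ^ 'n)) set"
  assumes "graded_semigroup G"
    and "complete_rank G"
    and "finite_sections G"
    and "limited_growth G"
  shows "\<exists>!M. \<exists>C T A. semigroup_of_type C T A M \<and> approximates C M G"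
proof (rule ex1I)
  have C: "positive_cone (closure (gcone G))"
    using assms(1,2,4) by (rule closure_gcone_positive)
  show "\<exists>C T A. semigroup_of_type C T A {p \<in> group_closure G. real_point p \<in> closure (gcone G)} \<and>
      approximates C {p \<in> group_closure G. real_point p \<in> closure (gcone G)} G"
    using closure_gcone_type[OF assms(1,2) C] closure_gcone_approximates[OF assms(1) C] by blast
\<comment> \<open>Any approximating semigroup, whatever its \<open>C\<close>, \<open>T\<close> and
  \<open>A\<close>, equals one set expressed through \<open>G\<close> alone.\<close>
qed (use approximating_semigroup_unique[OF assms(1,2)] in blast)

end
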